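(* Let $\mathcal{C}$ be an $\mathbf{Ord}$-category with pullbacks, $\mathcal{B}$ an $\mathbf{Ord}$-category with comma-objects, and $S\dashv G\colon\mathcal{B}\to\mathcal{C}$ an adjunction of $\mathbf{Ord}$-functors with unit $\eta$ and counit $\varepsilon$. Let $(L,\Phi)$ be the associated copointed endofunctor of $\mathcal{C}^{\mathbf 2}$ and $S\text{-Emb}$ the $\mathbf{Ord}$-category of $S$-embeddings. The following statements are equivalent. (1) The adjunction $S\dashv G$ is simple. (2) The locally monotone forgetful functor $U\colon S\text{-Emb}\to\mathcal{C}^{\mathbf 2}$ has a right adjoint and the induced comonad has underlying functor $L$ and counit $\Phi\colon L\Rightarrow 1_{\mathcal{C}^{\mathbf 2}}$. (3) The locally monotone copointed endofunctor $\Phi\colon L\Rightarrow1_{\mathcal{C}^{\mathbf 2}}$ admits a comultiplication $\Sigma\colon L\Rightarrow L^2$ making $\mathsf{L}=(L,\Phi,\Sigma)$ into a comonad whose category of coalgebras is isomorphic to $S\text{-Emb}$ over $\mathcal{C}^{\mathbf 2}$.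
   Context: $\mathbf{Ord}$ is the category of posets and monotone maps. An $\mathbf{Ord}$-category is a locally small category whose hom-sets are posets and whose composition is monotone in each variable; an $\mathbf{Ord}$-functor (= locally monotone functor) is a functor monotone on hom-posets. Adjunctions, comonads and limits (pullbacks, comma-objects) are $\mathbf{Ord}$-enriched. $\mathcal{C}^{\mathbf 2}$ is the arrow category, with morphisms $f\to g$ the pairs $(h,k)$ with $g\cdot h=k\cdot f$, ordered componentwise. The comma-object of $f\colon X\to Z\leftarrow Y\colon g$ is the universal object $f\downarrow g$ with projections $d_0,d_1$ to $X,Y$ satisfying $f\cdot d_0\le g\cdot d_1$ (with order on morphisms into it determined by $d_0,d_1$). Construction of $(L,\Phi)$: for $f\colon X\to Y$ in $\mathcal{C}$, let $Kf=GSf\downarrow\eta_Y$ be the comma-object in $\mathcal{C}$ of $GSf\colon GSX\to GSY$ and $\eta_Y\colon Y\to GSY$, with projections $q_f\colon Kf\to GSX$ and $Rf\colon Kf\to Y$, $GSf\cdot q_f\le\eta_Y\cdot Rf$ (it exists, as the pullback along $\eta_Y$ of $G$ applied to the projection $Sf\downarrow1_{SY}\to SY$). Let $Lf\colon X\to Kf$ be the unique morphism with $q_f\cdot Lf=\eta_X$, $Rf\cdot Lf=f$. This defines an $\mathbf{Ord}$-functorial factorisation $f=Rf\cdot Lf$ and hence a locally monotone endofunctor $L$ of $\mathcal{C}^{\mathbf 2}$, with copoint $\Phi_f=(1_X,Rf)\colon Lf\to f$. $S\text{-Emb}$: objects are pairs $(f,r)$ with $f\colon X\to Y$ in $\mathcal{C}$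 and $r\colon SY\to SX$ in $\mathcal{B}$ with $r\cdot Sf=1$ and $Sf\cdot r\le1$; morphisms $(f,r)\to(g,t)$ are morphisms $(h,k)\colon f\to g$ of $\mathcal{C}^{\mathbf 2}$ with $Sh\cdot r=t\cdot Sk$, ordered as in $\mathcal{C}^{\mathbf 2}$; $U(f,r)=f$. The adjunction $S\dashv G$ is simple if for every $f\colon X\to Y$ in $\mathcal{C}$ the morphism $Lf$ is an $S$-embedding with right adjoint $\varepsilon_{SX}\cdot Sq_f\colon SKf\to SGSX\to SX$ of $SLf$; equivalently, $SLf\cdot\varepsilon_{SX}\cdot Sq_f\le1$. *)

theory Defs
  imports Main
begin

section \<open>Ord-categories\<close>

text \<open>Objects and arrows are carved out of types by carrier sets; the fields are constrained only on
  these carriers, and \<open>Leq\<close> is used only between parallel arrows.\<close>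

record ('o, 'm) ordcat =
  Obj :: "'o set"
  Arr :: "'m set"
  Dom :: "'m \<Rightarrow> 'o"
  Cod :: "'m \<Rightarrow> 'o"
  Idn :: "'o \<Rightarrow> 'm"
  Comp :: "'m \<Rightarrow> 'm \<Rightarrow> 'm" (infixr "\<cdot>\<index>" 70)
  Leq :: "'m \<Rightarrow> 'm \<Rightarrow> bool" (infix "\<preceq>\<index>" 50)

definition hom :: "('o, 'm) ordcat \<Rightarrow> 'o \<Rightarrow> 'o \<Rightarrow> 'm set" where
  "hom C X Y = {f \<in> Arr C. Dom C f = X \<and> Cod C f = Y}"

locale ord_category =
  fixes C :: "('o, 'm) ordcat" (structure)
  assumes dom_obj: "f \<in> Arr C \<Longrightarrow> Dom C f \<in> Obj C"
    and cod_obj: "f \<in> Arr C \<Longrightarrow> Cod C f \<in> Obj C"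
    and id_hom: "X \<in> Obj C \<Longrightarrow> Idn C X \<in> hom C X X"
    and comp_hom: "f \<in> hom C X Y \<Longrightarrow> g \<in> hom C Y Z \<Longrightarrow> g \<cdot> f \<in> hom C X Z"
    and comp_id: "f \<in> hom C X Y \<Longrightarrow> f \<cdot> Idn C X = f"
    and id_comp: "f \<in> hom C X Y \<Longrightarrow> Idn C Y \<cdot> f = f"
    and comp_assoc: "f \<in> hom C W X \<Longrightarrow> g \<in> hom C X Y \<Longrightarrow> h \<in> hom C Y Z \<Longrightarrow>
      (h \<cdot> g) \<cdot> f = h \<cdot> (g \<cdot> f)"
    and leq_refl: "f \<in> hom C X Y \<Longrightarrow> f \<preceq> f"
    and leq_antisym: "f \<in> hom C X Y \<Longrightarrow> g \<in> hom C X Y \<Longrightarrow> f \<preceq> g \<Longrightarrow> g \<preceq> f \<Longrightarrow> f = g"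
    and leq_trans: "f \<in> hom C X Y \<Longrightarrow> g \<in> hom C X Y \<Longrightarrow> h \<in> hom C X Y \<Longrightarrow>
      f \<preceq> g \<Longrightarrow> g \<preceq> h \<Longrightarrow> f \<preceq> h"
    and comp_mono: "f \<in> hom C X Y \<Longrightarrow> f' \<in> hom C X Y \<Longrightarrow> g \<in> hom C Y Z \<Longrightarrow> g' \<in> hom C Y Z \<Longrightarrow>
      f \<preceq> f' \<Longrightarrow> g \<preceq> g' \<Longrightarrow> g \<cdot> f \<preceq> g' \<cdot> f'"

definition is_pullback :: "('o, 'm) ordcat \<Rightarrow> 'm \<Rightarrow> 'm \<Rightarrow> 'm \<Rightarrow> 'm \<Rightarrow> bool" where
  "is_pullback C f g p0 p1 \<longleftrightarrow>
     (\<exists>P. p0 \<in> hom C P (Dom C f) \<and> p1 \<in> hom C P (Dom C g) \<and>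
        f \<cdot>\<^bsub>C\<^esub> p0 = g \<cdot>\<^bsub>C\<^esub> p1 \<and>
        (\<forall>W\<in>Obj C. \<forall>u\<in>hom C W (Dom C f). \<forall>v\<in>hom C W (Dom C g).
           f \<cdot>\<^bsub>C\<^esub> u = g \<cdot>\<^bsub>C\<^esub> v \<longrightarrow>
           (\<exists>!w. w \<in> hom C W P \<and> p0 \<cdot>\<^bsub>C\<^esub> w = u \<and> p1 \<cdot>\<^bsub>C\<^esub> w = v)) \<and>
        (\<forall>W\<in>Obj C. \<forall>w\<in>hom C W P. \<forall>w'\<in>hom C W P.
           p0 \<cdot>\<^bsub>C\<^esub> w \<preceq>\<^bsub>C\<^esub> p0 \<cdot>\<^bsub>C\<^esub> w' \<and> p1 \<cdot>\<^bsub>C\<^esub> w \<preceq>\<^bsub>C\<^esub> p1 \<cdot>\<^bsub>C\<^esub> w' \<longrightarrow>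
           w \<preceq>\<^bsub>C\<^esub> w'))"

definition is_comma :: "('o, 'm) ordcat \<Rightarrow> 'm \<Rightarrow> 'm \<Rightarrow> 'm \<Rightarrow> 'm \<Rightarrow> bool" where
  "is_comma C f g d0 d1 \<longleftrightarrow>
     (\<exists>P. d0 \<in> hom C P (Dom C f) \<and> d1 \<in> hom C P (Dom C g) \<and>
        f \<cdot>\<^bsub>C\<^esub> d0 \<preceq>\<^bsub>C\<^esub> g \<cdot>\<^bsub>C\<^esub> d1 \<and>
        (\<forall>W\<in>Obj C. \<forall>u\<in>hom C W (Dom C f). \<forall>v\<in>hom C W (Dom C g).
           f \<cdot>\<^bsub>C\<^esub> u \<preceq>\<^bsub>C\<^esub> g \<cdot>\<^bsub>C\<^esub> v \<longrightarrow>
           (\<exists>!w. w \<in> hom C W P \<and> d0 \<cdot>\<^bsub>C\<^esub> w = u \<and> d1 \<cdot>\<^bsub>C\<^esub> w = v)) \<and>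
        (\<forall>W\<in>Obj C. \<forall>w\<in>hom C W P. \<forall>w'\<in>hom C W P.
           d0 \<cdot>\<^bsub>C\<^esub> w \<preceq>\<^bsub>C\<^esub> d0 \<cdot>\<^bsub>C\<^esub> w' \<and> d1 \<cdot>\<^bsub>C\<^esub> w \<preceq>\<^bsub>C\<^esub> d1 \<cdot>\<^bsub>C\<^esub> w' \<longrightarrow>
           w \<preceq>\<^bsub>C\<^esub> w'))"

definition has_pullbacks :: "('o, 'm) ordcat \<Rightarrow> bool" where
  "has_pullbacks C \<longleftrightarrow>
     (\<forall>f\<in>Arr C. \<forall>g\<in>Arr C. Cod C f = Cod C g \<longrightarrow> (\<exists>p0 p1. is_pullback C f g p0 p1))"

definition has_comma_objects :: "('o, 'm) ordcat \<Rightarrow> bool" where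
  "has_comma_objects C \<longleftrightarrow>
     (\<forall>f\<in>Arr C. \<forall>g\<in>Arr C. Cod C f = Cod C g \<longrightarrow> (\<exists>d0 d1. is_comma C f g d0 d1))"

section \<open>Ord-functors, adjunctions, comonads\<close>

record ('o, 'm, 'p, 'n) func =
  OMap :: "'o \<Rightarrow> 'p"
  AMap :: "'m \<Rightarrow> 'n"

locale ord_functor = A: ord_category A + B: ord_category B
  for A :: "('o, 'm) ordcat" and B :: "('p, 'n) ordcat" +
  fixes F :: "('o, 'm, 'p, 'n) func"
  assumes map_obj: "X \<in> Obj A \<Longrightarrow> OMap F X \<in> Obj B"
    and map_hom: "f \<in> hom A X Y \<Longrightarrow> AMap F f \<in> hom B (OMap F X) (OMap F Y)"
    and map_id: "X \<in> Obj A \<Longrightarrow> AMap F (Idn A X) = Idn B (OMap F X)"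
    and map_comp: "f \<in> hom A X Y \<Longrightarrow> g \<in> hom A Y Z \<Longrightarrow>
      AMap F (g \<cdot>\<^bsub>A\<^esub> f) = AMap F g \<cdot>\<^bsub>B\<^esub> AMap F f"
    and map_mono: "f \<in> hom A X Y \<Longrightarrow> g \<in> hom A X Y \<Longrightarrow> f \<preceq>\<^bsub>A\<^esub> g \<Longrightarrow>
      AMap F f \<preceq>\<^bsub>B\<^esub> AMap F g"

definition id_func :: "('o, 'm, 'o, 'm) func" where
  "id_func = \<lparr>OMap = (\<lambda>X. X), AMap = (\<lambda>f. f)\<rparr>"

definition comp_func :: "('p, 'n, 'q, 'k) func \<Rightarrow> ('o, 'm, 'p, 'n) func \<Rightarrow> ('o, 'm, 'q, 'k) func"
  (infixr "\<circ>\<^sub>F" 55) where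
  "G \<circ>\<^sub>F F = \<lparr>OMap = OMap G \<circ> OMap F, AMap = AMap G \<circ> AMap F\<rparr>"

text \<open>Equality of functors with domain \<open>A\<close>; values outside the carriers of \<open>A\<close> are irrelevant.\<close>

definition func_eq :: "('o, 'm) ordcat \<Rightarrow> ('o, 'm, 'p, 'n) func \<Rightarrow> ('o, 'm, 'p, 'n) func \<Rightarrow> bool" where
  "func_eq A F G \<longleftrightarrow> (\<forall>X\<in>Obj A. OMap F X = OMap G X) \<and> (\<forall>f\<in>Arr A. AMap F f = AMap G f)"

locale nat_trans = F: ord_functor A B F + G: ord_functor A B G
  for A :: "('o, 'm) ordcat" and B :: "('p, 'n) ordcat"
    and F :: "('o, 'm, 'p, 'n) func" and G :: "('o, 'm, 'p, 'n) func" +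
  fixes t :: "'o \<Rightarrow> 'n"
  assumes component: "X \<in> Obj A \<Longrightarrow> t X \<in> hom B (OMap F X) (OMap G X)"
    and naturality: "f \<in> hom A X Y \<Longrightarrow> AMap G f \<cdot>\<^bsub>B\<^esub> t X = t Y \<cdot>\<^bsub>B\<^esub> AMap F f"

text \<open>\<open>F\<close> is left adjoint to \<open>G\<close>. As both are locally monotone, transposition along unit and counit
  is an isomorphism of hom-posets, so this is the Ord-enriched notion.\<close>

locale ord_adjunction =
  F: ord_functor A B F + G: ord_functor B A G +
  unit: nat_trans A A id_func "G \<circ>\<^sub>F F" \<eta> + counit: nat_trans B B "F \<circ>\<^sub>F G" id_func \<epsilon>
  for A :: "('o, 'm) ordcat" and B :: "('p, 'n) ordcat"
    and F :: "('o, 'm, 'p, 'n) func" and G :: "('p, 'n, 'o, 'm) func"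
    and \<eta> :: "'o \<Rightarrow> 'm" and \<epsilon> :: "'p \<Rightarrow> 'n" +
  assumes triangle_left: "X \<in> Obj A \<Longrightarrow> \<epsilon> (OMap F X) \<cdot>\<^bsub>B\<^esub> AMap F (\<eta> X) = Idn B (OMap F X)"
    and triangle_right: "Z \<in> Obj B \<Longrightarrow> AMap G (\<epsilon> Z) \<cdot>\<^bsub>A\<^esub> \<eta> (OMap G Z) = Idn A (OMap G Z)"

locale ord_comonad =
  counit: nat_trans D D W id_func e + comult: nat_trans D D W "W \<circ>\<^sub>F W" d
  for D :: "('o, 'm) ordcat" and W :: "('o, 'm, 'o, 'm) func"
    and e :: "'o \<Rightarrow> 'm" and d :: "'o \<Rightarrow> 'm" +
  assumes counit_left: "X \<in> Obj D \<Longrightarrow> e (OMap W X) \<cdot>\<^bsub>D\<^esub> d X = Idn D (OMap W X)"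
    and counit_right: "X \<in> Obj D \<Longrightarrow> AMap W (e X) \<cdot>\<^bsub>D\<^esub> d X = Idn D (OMap W X)"
    and coassoc: "X \<in> Obj D \<Longrightarrow> d (OMap W X) \<cdot>\<^bsub>D\<^esub> d X = AMap W (d X) \<cdot>\<^bsub>D\<^esub> d X"

text \<open>An arrow of the category of coalgebras records its source and target coalgebras.\<close>

definition coalgebras :: "('o, 'm) ordcat \<Rightarrow> ('o, 'm, 'o, 'm) func \<Rightarrow> ('o \<Rightarrow> 'm) \<Rightarrow> ('o \<Rightarrow> 'm) \<Rightarrow>
    ('o \<times> 'm, ('o \<times> 'm) \<times> 'm \<times> ('o \<times> 'm)) ordcat" where
  "coalgebras D W e d =
     (let coalg = {(X, a). X \<in> Obj D \<and> a \<in> hom D X (OMap W X) \<and>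
                     e X \<cdot>\<^bsub>D\<^esub> a = Idn D X \<and> d X \<cdot>\<^bsub>D\<^esub> a = AMap W a \<cdot>\<^bsub>D\<^esub> a}
      in \<lparr>Obj = coalg,
          Arr = {((X, a), m, (Y, b)). (X, a) \<in> coalg \<and> (Y, b) \<in> coalg \<and> m \<in> hom D X Y \<and>
                   b \<cdot>\<^bsub>D\<^esub> m = AMap W m \<cdot>\<^bsub>D\<^esub> a},
          Dom = (\<lambda>(x, m, y). x),
          Cod = (\<lambda>(x, m, y). y),
          Idn = (\<lambda>(X, a). ((X, a), Idn D X, (X, a))),
          Comp = (\<lambda>(y, n, z) (x, m, y'). (x, n \<cdot>\<^bsub>D\<^esub> m, z)),
          Leq = (\<lambda>(x, m, y) (x', m', y'). m \<preceq>\<^bsub>D\<^esub> m')\<rparr>)"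

definition coalgebras_forget :: "('o \<times> 'm, ('o \<times> 'm) \<times> 'm \<times> ('o \<times> 'm), 'o, 'm) func" where
  "coalgebras_forget = \<lparr>OMap = fst, AMap = (\<lambda>(x, m, y). m)\<rparr>"

definition iso_over :: "('o, 'm) ordcat \<Rightarrow> ('o, 'm, 'q, 'k) func \<Rightarrow>
    ('p, 'n) ordcat \<Rightarrow> ('p, 'n, 'q, 'k) func \<Rightarrow> bool" where
  "iso_over A U B V \<longleftrightarrow>
     (\<exists>J J'. ord_functor A B J \<and> ord_functor B A J' \<and>
        func_eq A (J' \<circ>\<^sub>F J) id_func \<and> func_eq B (J \<circ>\<^sub>F J') id_func \<and> func_eq A (V \<circ>\<^sub>F J) U)"

section \<open>The arrow category and \<open>S\<close>-embeddings\<close>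

text \<open>The morphism \<open>(h, k) : f \<rightarrow> g\<close> is encoded as \<open>(f, (h, k), g)\<close>.\<close>

type_synonym 'm square = "'m \<times> ('m \<times> 'm) \<times> 'm"

definition arrow_cat :: "('o, 'm) ordcat \<Rightarrow> ('m, 'm square) ordcat" where
  "arrow_cat C =
     \<lparr>Obj = Arr C,
      Arr = {(f, (h, k), g). f \<in> Arr C \<and> g \<in> Arr C \<and>
               h \<in> hom C (Dom C f) (Dom C g) \<and> k \<in> hom C (Cod C f) (Cod C g) \<and>
               g \<cdot>\<^bsub>C\<^esub> h = k \<cdot>\<^bsub>C\<^esub> f},
      Dom = (\<lambda>(f, hk, g). f),
      Cod = (\<lambda>(f, hk, g). g),
      Idn = (\<lambda>f. (f, (Idn C (Dom C f), Idn C (Cod C f)), f)),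
      Comp = (\<lambda>(g, (h', k'), l) (f, (h, k), g'). (f, (h' \<cdot>\<^bsub>C\<^esub> h, k' \<cdot>\<^bsub>C\<^esub> k), l)),
      Leq = (\<lambda>(f, (h, k), g) (f', (h', k'), g'). h \<preceq>\<^bsub>C\<^esub> h' \<and> k \<preceq>\<^bsub>C\<^esub> k')\<rparr>"

definition is_embedding :: "('o, 'm) ordcat \<Rightarrow> ('p, 'n) ordcat \<Rightarrow> ('o, 'm, 'p, 'n) func \<Rightarrow>
    'm \<Rightarrow> 'n \<Rightarrow> bool" where
  "is_embedding C B S f r \<longleftrightarrow>
     f \<in> Arr C \<and> r \<in> hom B (OMap S (Cod C f)) (OMap S (Dom C f)) \<and>
     r \<cdot>\<^bsub>B\<^esub> AMap S f = Idn B (OMap S (Dom C f)) \<and>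
     AMap S f \<cdot>\<^bsub>B\<^esub> r \<preceq>\<^bsub>B\<^esub> Idn B (OMap S (Cod C f))"

type_synonym ('m, 'n) emb_arrow = "('m \<times> 'n) \<times> ('m \<times> 'm) \<times> ('m \<times> 'n)"

definition Emb :: "('o, 'm) ordcat \<Rightarrow> ('p, 'n) ordcat \<Rightarrow> ('o, 'm, 'p, 'n) func \<Rightarrow>
    ('m \<times> 'n, ('m, 'n) emb_arrow) ordcat" where
  "Emb C B S =
     \<lparr>Obj = {(f, r). is_embedding C B S f r},
      Arr = {((f, r), (h, k), (g, t)). is_embedding C B S f r \<and> is_embedding C B S g t \<and>
               (f, (h, k), g) \<in> Arr (arrow_cat C) \<and>
               AMap S h \<cdot>\<^bsub>B\<^esub> r = t \<cdot>\<^bsub>B\<^esub> AMap S k},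
      Dom = (\<lambda>(x, hk, y). x),
      Cod = (\<lambda>(x, hk, y). y),
      Idn = (\<lambda>(f, r). ((f, r), (Idn C (Dom C f), Idn C (Cod C f)), (f, r))),
      Comp = (\<lambda>(y, (h', k'), z) (x, (h, k), y'). (x, (h' \<cdot>\<^bsub>C\<^esub> h, k' \<cdot>\<^bsub>C\<^esub> k), z)),
      Leq = (\<lambda>(x, (h, k), y) (x', (h', k'), y'). h \<preceq>\<^bsub>C\<^esub> h' \<and> k \<preceq>\<^bsub>C\<^esub> k')\<rparr>"

definition Emb_forget :: "('m \<times> 'n, ('m, 'n) emb_arrow, 'm, 'm square) func" where
  "Emb_forget = \<lparr>OMap = fst, AMap = (\<lambda>((f, r), hk, (g, t)). (f, hk, g))\<rparr>"

section \<open>The copointed endofunctor\<close>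

text \<open>A choice, for every arrow \<open>f\<close>, of a comma-object of \<open>GSf\<close> and \<open>\<eta>\<^bsub>cod f\<^esub>\<close>, given by its
  projections \<open>q f\<close> and \<open>R f\<close>; the object \<open>Kf\<close> is \<open>Dom C (q f)\<close>. Such a choice exists by
  \<open>comma_choice_exists\<close> below.\<close>

definition comma_choice :: "('o, 'm) ordcat \<Rightarrow> ('o, 'm, 'p, 'n) func \<Rightarrow> ('p, 'n, 'o, 'm) func \<Rightarrow>
    ('o \<Rightarrow> 'm) \<Rightarrow> ('m \<Rightarrow> 'm) \<Rightarrow> ('m \<Rightarrow> 'm) \<Rightarrow> bool" where
  "comma_choice C S G \<eta> q R \<longleftrightarrow>
     (\<forall>f\<in>Arr C. is_comma C (AMap G (AMap S f)) (\<eta> (Cod C f)) (q f) (R f))"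

lemma (in ord_category) hom_arr: "f \<in> hom C X Y \<Longrightarrow> f \<in> Arr C \<and> Dom C f = X \<and> Cod C f = Y"
  by (simp add: hom_def)

lemma (in ord_category) arr_hom: "f \<in> Arr C \<Longrightarrow> f \<in> hom C (Dom C f) (Cod C f)"
  by (simp add: hom_def)

lemma (in ord_category) hom_objs: "f \<in> hom C X Y \<Longrightarrow> X \<in> Obj C \<and> Y \<in> Obj C"
  using dom_obj cod_obj by (auto simp: hom_def)

context ord_adjunction
begin

lemma eta_hom: "X \<in> Obj A \<Longrightarrow> \<eta> X \<in> hom A X (OMap G (OMap F X))"
  using unit.component[of X] by (simp add: id_func_def comp_func_def)

lemma eps_hom: "Z \<in> Obj B \<Longrightarrow> \<epsilon> Z \<in> hom B (OMap F (OMap G Z)) Z"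
  using counit.component[of Z] by (simp add: id_func_def comp_func_def)

lemma eta_nat: "f \<in> hom A X Y \<Longrightarrow> AMap G (AMap F f) \<cdot>\<^bsub>A\<^esub> \<eta> X = \<eta> Y \<cdot>\<^bsub>A\<^esub> f"
  using unit.naturality[of f X Y] by (simp add: id_func_def comp_func_def)

lemma eps_nat: "f \<in> hom B X Y \<Longrightarrow> f \<cdot>\<^bsub>B\<^esub> \<epsilon> X = \<epsilon> Y \<cdot>\<^bsub>B\<^esub> AMap F (AMap G f)"
  using counit.naturality[of f X Y] by (simp add: id_func_def comp_func_def)

lemma transpose_hom:
  assumes "u \<in> hom A W (OMap G Z)" "Z \<in> Obj B"
  shows "\<epsilon> Z \<cdot>\<^bsub>B\<^esub> AMap F u \<in> hom B (OMap F W) Z"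
  using assms F.B.comp_hom F.map_hom eps_hom by blast

lemma transpose_mono:
  assumes "u \<in> hom A W (OMap G Z)" "v \<in> hom A W (OMap G Z)" "Z \<in> Obj B" "u \<preceq>\<^bsub>A\<^esub> v"
  shows "\<epsilon> Z \<cdot>\<^bsub>B\<^esub> AMap F u \<preceq>\<^bsub>B\<^esub> \<epsilon> Z \<cdot>\<^bsub>B\<^esub> AMap F v"
  using assms F.B.comp_mono[OF F.map_hom F.map_hom eps_hom eps_hom] F.map_mono F.B.leq_refl eps_hom
  by blast

lemma transpose_comp:
  assumes u: "u \<in> hom A W (OMap G Z)" and p: "p \<in> hom B Z Z'"
  shows "p \<cdot>\<^bsub>B\<^esub> (\<epsilon> Z \<cdot>\<^bsub>B\<^esub> AMap F u) = \<epsilon> Z' \<cdot>\<^bsub>B\<^esub> AMap F (AMap G p \<cdot>\<^bsub>A\<^esub> u)"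
proof -
  have Z: "Z \<in> Obj B" "Z' \<in> Obj B" using p F.B.hom_objs by blast+
  have Gp: "AMap G p \<in> hom A (OMap G Z) (OMap G Z')" using p G.map_hom by blast
  show ?thesis
    using F.B.comp_assoc[OF F.map_hom[OF u] eps_hom p] F.map_comp[OF u Gp] eps_nat[OF p] Z
      F.B.comp_assoc[OF F.map_hom[OF u] F.map_hom[OF Gp] eps_hom] by simp
qed

lemma transpose_back:
  assumes u: "u \<in> hom A W (OMap G Z)" and Z: "Z \<in> Obj B"
  shows "AMap G (\<epsilon> Z \<cdot>\<^bsub>B\<^esub> AMap F u) \<cdot>\<^bsub>A\<^esub> \<eta> W = u"
proof -
  have W: "W \<in> Obj A" and GZ: "OMap G Z \<in> Obj A" using u F.A.hom_objs by blast+
  note Fu = F.map_hom[OF u] and e = eps_hom[OF Z]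
  have "AMap G (\<epsilon> Z \<cdot>\<^bsub>B\<^esub> AMap F u) \<cdot>\<^bsub>A\<^esub> \<eta> W = (AMap G (\<epsilon> Z) \<cdot>\<^bsub>A\<^esub> AMap G (AMap F u)) \<cdot>\<^bsub>A\<^esub> \<eta> W"
    using G.map_comp[OF Fu e] by simp
  also have "\<dots> = AMap G (\<epsilon> Z) \<cdot>\<^bsub>A\<^esub> (\<eta> (OMap G Z) \<cdot>\<^bsub>A\<^esub> u)"
    using F.A.comp_assoc[OF eta_hom[OF W] G.map_hom[OF Fu] G.map_hom[OF e]] eta_nat[OF u] by simp
  also have "\<dots> = Idn A (OMap G Z) \<cdot>\<^bsub>A\<^esub> u"
    using F.A.comp_assoc[OF u eta_hom[OF GZ] G.map_hom[OF e]] triangle_right[OF Z] by simp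
  finally show ?thesis using F.A.id_comp[OF u] by simp
qed

lemma transpose_unit:
  assumes v: "v \<in> hom A W Y"
  shows "\<epsilon> (OMap F Y) \<cdot>\<^bsub>B\<^esub> AMap F (\<eta> Y \<cdot>\<^bsub>A\<^esub> v) = AMap F v"
proof -
  have Y: "Y \<in> Obj A" using v F.A.hom_objs by blast
  then have FY: "OMap F Y \<in> Obj B" by (rule F.map_obj)
  show ?thesis
    using F.map_comp[OF v eta_hom[OF Y]] triangle_left[OF Y] F.B.id_comp[OF F.map_hom[OF v]]
      F.B.comp_assoc[OF F.map_hom[OF v] F.map_hom[OF eta_hom[OF Y]] eps_hom[OF FY]] by simp
qed

text \<open>The comma-object of \<open>GFf\<close> and \<open>\<eta>\<close> is the pullback along \<open>\<eta>\<close> of \<open>G\<close> applied to the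
  projection \<open>Ff \<down> 1 \<rightarrow> FY\<close>.\<close>

lemma comma_exists:
  assumes f: "f \<in> hom A X Y"
    and cm: "is_comma B (AMap F f) (Idn B (OMap F Y)) p0 p1"
    and pb: "is_pullback A (AMap G p1) (\<eta> Y) a r"
  shows "is_comma A (AMap G (AMap F f)) (\<eta> Y) (AMap G p0 \<cdot>\<^bsub>A\<^esub> a) r"
proof -
  let ?FX = "OMap F X" and ?FY = "OMap F Y"
  have XY: "X \<in> Obj A" "Y \<in> Obj A" using f F.A.hom_objs by blast+
  have FXY: "?FX \<in> Obj B" "?FY \<in> Obj B" using XY F.map_obj by blast+
  note Ff = F.map_hom[OF f]
  note GFf = G.map_hom[OF Ff]
  note etaY = eta_hom[OF XY(2)]
  note idY = F.B.id_hom[OF FXY(2)]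
  have doms: "Dom B (AMap F f) = ?FX" "Dom B (Idn B ?FY) = ?FY" "Dom A (\<eta> Y) = Y"
    "Dom A (AMap G (AMap F f)) = OMap G ?FX"
    using Ff idY etaY GFf F.B.hom_arr F.A.hom_arr by blast+
  from cm[unfolded is_comma_def doms] obtain P where
    p0: "p0 \<in> hom B P ?FX" and p1: "p1 \<in> hom B P ?FY"
    and ple: "AMap F f \<cdot>\<^bsub>B\<^esub> p0 \<preceq>\<^bsub>B\<^esub> Idn B ?FY \<cdot>\<^bsub>B\<^esub> p1"
    and puni: "\<forall>W\<in>Obj B. \<forall>u\<in>hom B W ?FX. \<forall>v\<in>hom B W ?FY.
        AMap F f \<cdot>\<^bsub>B\<^esub> u \<preceq>\<^bsub>B\<^esub> Idn B ?FY \<cdot>\<^bsub>B\<^esub> v \<longrightarrow>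
        (\<exists>!w. w \<in> hom B W P \<and> p0 \<cdot>\<^bsub>B\<^esub> w = u \<and> p1 \<cdot>\<^bsub>B\<^esub> w = v)"
    and pord: "\<forall>W\<in>Obj B. \<forall>w\<in>hom B W P. \<forall>w'\<in>hom B W P.
        p0 \<cdot>\<^bsub>B\<^esub> w \<preceq>\<^bsub>B\<^esub> p0 \<cdot>\<^bsub>B\<^esub> w' \<and> p1 \<cdot>\<^bsub>B\<^esub> w \<preceq>\<^bsub>B\<^esub> p1 \<cdot>\<^bsub>B\<^esub> w' \<longrightarrow> w \<preceq>\<^bsub>B\<^esub> w'"
    by (elim exE conjE) (rule that)
  have P: "P \<in> Obj B" using p0 F.B.hom_objs by blast
  note Gp0 = G.map_hom[OF p0] and Gp1 = G.map_hom[OF p1]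
  have dG: "Dom A (AMap G p1) = OMap G P" using Gp1 F.A.hom_arr by blast
  from pb[unfolded is_pullback_def doms dG] obtain K where
    a: "a \<in> hom A K (OMap G P)" and r: "r \<in> hom A K Y"
    and sq: "AMap G p1 \<cdot>\<^bsub>A\<^esub> a = \<eta> Y \<cdot>\<^bsub>A\<^esub> r"
    and kuni: "\<forall>W\<in>Obj A. \<forall>u\<in>hom A W (OMap G P). \<forall>v\<in>hom A W Y.
        AMap G p1 \<cdot>\<^bsub>A\<^esub> u = \<eta> Y \<cdot>\<^bsub>A\<^esub> v \<longrightarrow>
        (\<exists>!w. w \<in> hom A W K \<and> a \<cdot>\<^bsub>A\<^esub> w = u \<and> r \<cdot>\<^bsub>A\<^esub> w = v)"
    and kord: "\<forall>W\<in>Obj A. \<forall>w\<in>hom A W K. \<forall>w'\<in>hom A W K.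
        a \<cdot>\<^bsub>A\<^esub> w \<preceq>\<^bsub>A\<^esub> a \<cdot>\<^bsub>A\<^esub> w' \<and> r \<cdot>\<^bsub>A\<^esub> w \<preceq>\<^bsub>A\<^esub> r \<cdot>\<^bsub>A\<^esub> w' \<longrightarrow> w \<preceq>\<^bsub>A\<^esub> w'"
    by (elim exE conjE) (rule that)
  let ?q = "AMap G p0 \<cdot>\<^bsub>A\<^esub> a"
  have q: "?q \<in> hom A K (OMap G ?FX)" using F.A.comp_hom[OF a Gp0] .
  have le: "AMap G (AMap F f) \<cdot>\<^bsub>A\<^esub> ?q \<preceq>\<^bsub>A\<^esub> \<eta> Y \<cdot>\<^bsub>A\<^esub> r"
  proof -
    have fp0: "AMap F f \<cdot>\<^bsub>B\<^esub> p0 \<in> hom B P ?FY" using F.B.comp_hom[OF p0 Ff] .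
    have "AMap F f \<cdot>\<^bsub>B\<^esub> p0 \<preceq>\<^bsub>B\<^esub> p1" using ple F.B.id_comp[OF p1] by simp
    then have "AMap G (AMap F f \<cdot>\<^bsub>B\<^esub> p0) \<preceq>\<^bsub>A\<^esub> AMap G p1" using G.map_mono[OF fp0 p1] by simp
    then have "AMap G (AMap F f \<cdot>\<^bsub>B\<^esub> p0) \<cdot>\<^bsub>A\<^esub> a \<preceq>\<^bsub>A\<^esub> AMap G p1 \<cdot>\<^bsub>A\<^esub> a"
      using F.A.comp_mono[OF a a G.map_hom[OF fp0] Gp1] F.A.leq_refl[OF a] by simp
    then show ?thesis
      using G.map_comp[OF p0 Ff] F.A.comp_assoc[OF a Gp0 GFf] sq by simp
  qed
  have ord: "w \<preceq>\<^bsub>A\<^esub> w'" if W: "W \<in> Obj A" and w: "w \<in> hom A W K" and w': "w' \<in> hom A W K"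
    and l0: "?q \<cdot>\<^bsub>A\<^esub> w \<preceq>\<^bsub>A\<^esub> ?q \<cdot>\<^bsub>A\<^esub> w'" and l1: "r \<cdot>\<^bsub>A\<^esub> w \<preceq>\<^bsub>A\<^esub> r \<cdot>\<^bsub>A\<^esub> w'" for W w w'
  proof -
    let ?t = "\<lambda>w. \<epsilon> P \<cdot>\<^bsub>B\<^esub> AMap F (a \<cdot>\<^bsub>A\<^esub> w)"
    have FW: "OMap F W \<in> Obj B" using W F.map_obj by blast
    have aw: "a \<cdot>\<^bsub>A\<^esub> w \<in> hom A W (OMap G P)" "a \<cdot>\<^bsub>A\<^esub> w' \<in> hom A W (OMap G P)"
      using a w w' F.A.comp_hom by blast+
    have t: "?t w \<in> hom B (OMap F W) P" "?t w' \<in> hom B (OMap F W) P"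
      using transpose_hom aw P by blast+
    have t0: "p0 \<cdot>\<^bsub>B\<^esub> ?t x = \<epsilon> ?FX \<cdot>\<^bsub>B\<^esub> AMap F (?q \<cdot>\<^bsub>A\<^esub> x)" if "x \<in> hom A W K" for x
      using transpose_comp[OF F.A.comp_hom[OF that a] p0] F.A.comp_assoc[OF that a Gp0] by simp
    have t1: "p1 \<cdot>\<^bsub>B\<^esub> ?t x = AMap F (r \<cdot>\<^bsub>A\<^esub> x)" if x: "x \<in> hom A W K" for x
      using transpose_comp[OF F.A.comp_hom[OF x a] p1] F.A.comp_assoc[OF x a Gp1] sq
        F.A.comp_assoc[OF x r etaY] transpose_unit[OF F.A.comp_hom[OF x r]] by simp
    have "p0 \<cdot>\<^bsub>B\<^esub> ?t w \<preceq>\<^bsub>B\<^esub> p0 \<cdot>\<^bsub>B\<^esub> ?t w'"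
      unfolding t0[OF w] t0[OF w']
      by (rule transpose_mono[OF F.A.comp_hom[OF w q] F.A.comp_hom[OF w' q] FXY(1) l0])
    moreover have "p1 \<cdot>\<^bsub>B\<^esub> ?t w \<preceq>\<^bsub>B\<^esub> p1 \<cdot>\<^bsub>B\<^esub> ?t w'"
      unfolding t1[OF w] t1[OF w']
      by (rule F.map_mono[OF F.A.comp_hom[OF w r] F.A.comp_hom[OF w' r] l1])
    ultimately have tt: "?t w \<preceq>\<^bsub>B\<^esub> ?t w'" using pord FW t by blast
    then have "AMap G (?t w) \<cdot>\<^bsub>A\<^esub> \<eta> W \<preceq>\<^bsub>A\<^esub> AMap G (?t w') \<cdot>\<^bsub>A\<^esub> \<eta> W"
      using F.A.comp_mono[OF eta_hom[OF W] eta_hom[OF W] G.map_hom[OF t(1)] G.map_hom[OF t(2)]]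
        F.A.leq_refl[OF eta_hom[OF W]] G.map_mono[OF t tt] by simp
    then have "a \<cdot>\<^bsub>A\<^esub> w \<preceq>\<^bsub>A\<^esub> a \<cdot>\<^bsub>A\<^esub> w'"
      using transpose_back aw P by simp
    then show ?thesis using kord W w w' l1 by blast
  qed
  have ex: "\<exists>w. w \<in> hom A W K \<and> ?q \<cdot>\<^bsub>A\<^esub> w = u \<and> r \<cdot>\<^bsub>A\<^esub> w = v"
    if W: "W \<in> Obj A" and u: "u \<in> hom A W (OMap G ?FX)" and v: "v \<in> hom A W Y"
      and uv: "AMap G (AMap F f) \<cdot>\<^bsub>A\<^esub> u \<preceq>\<^bsub>A\<^esub> \<eta> Y \<cdot>\<^bsub>A\<^esub> v" for W u v
  proof -
    have FW: "OMap F W \<in> Obj B" using W F.map_obj by blast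
    let ?u = "\<epsilon> ?FX \<cdot>\<^bsub>B\<^esub> AMap F u"
    have u': "?u \<in> hom B (OMap F W) ?FX" using transpose_hom[OF u FXY(1)] .
    have Fv: "AMap F v \<in> hom B (OMap F W) ?FY" using F.map_hom[OF v] .
    have "AMap F f \<cdot>\<^bsub>B\<^esub> ?u \<preceq>\<^bsub>B\<^esub> AMap F v"
      using transpose_mono[OF F.A.comp_hom[OF u GFf] F.A.comp_hom[OF v etaY] FXY(2) uv]
      unfolding transpose_comp[OF u Ff] transpose_unit[OF v] .
    then have "AMap F f \<cdot>\<^bsub>B\<^esub> ?u \<preceq>\<^bsub>B\<^esub> Idn B ?FY \<cdot>\<^bsub>B\<^esub> AMap F v" using F.B.id_comp[OF Fv] by simp
    from puni[rule_format, OF FW u' Fv this] obtain x where x: "x \<in> hom B (OMap F W) P" "p0 \<cdot>\<^bsub>B\<^esub> x = ?u" "p1 \<cdot>\<^bsub>B\<^esub> x = AMap F v"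
      by (elim ex1E conjE) (rule that)
    let ?x = "AMap G x \<cdot>\<^bsub>A\<^esub> \<eta> W"
    note Gx = G.map_hom[OF x(1)] and eW = eta_hom[OF W]
    have x': "?x \<in> hom A W (OMap G P)" using F.A.comp_hom[OF eW Gx] .
    have "AMap G p1 \<cdot>\<^bsub>A\<^esub> ?x = \<eta> Y \<cdot>\<^bsub>A\<^esub> v"
      using F.A.comp_assoc[OF eW Gx Gp1] G.map_comp[OF x(1) p1] x(3) eta_nat[OF v] by simp
    from kuni[rule_format, OF W x' v this] obtain w where w: "w \<in> hom A W K" "a \<cdot>\<^bsub>A\<^esub> w = ?x" "r \<cdot>\<^bsub>A\<^esub> w = v"
      by (elim ex1E conjE) (rule that)
    have "AMap G p0 \<cdot>\<^bsub>A\<^esub> ?x = u"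
      using F.A.comp_assoc[OF eW Gx Gp0] G.map_comp[OF x(1) p0] x(2) transpose_back[OF u FXY(1)]
      by simp
    then have "?q \<cdot>\<^bsub>A\<^esub> w = u" using F.A.comp_assoc[OF w(1) a Gp0] w(2) by simp
    with w show ?thesis by blast
  qed
  have uni: "w = w'" if W: "W \<in> Obj A" and w: "w \<in> hom A W K" and w': "w' \<in> hom A W K"
    and "?q \<cdot>\<^bsub>A\<^esub> w = ?q \<cdot>\<^bsub>A\<^esub> w'" and "r \<cdot>\<^bsub>A\<^esub> w = r \<cdot>\<^bsub>A\<^esub> w'" for W w w'
  proof (rule F.A.leq_antisym[OF w w'])
    have refl: "?q \<cdot>\<^bsub>A\<^esub> w \<preceq>\<^bsub>A\<^esub> ?q \<cdot>\<^bsub>A\<^esub> w" "r \<cdot>\<^bsub>A\<^esub> w \<preceq>\<^bsub>A\<^esub> r \<cdot>\<^bsub>A\<^esub> w"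
      using F.A.leq_refl[OF F.A.comp_hom[OF w q]] F.A.leq_refl[OF F.A.comp_hom[OF w r]] .
    show "w \<preceq>\<^bsub>A\<^esub> w'" by (rule ord[OF W w w']) (use that refl in simp_all)
    show "w' \<preceq>\<^bsub>A\<^esub> w" by (rule ord[OF W w' w]) (use that refl in simp_all)
  qed
  have "\<exists>!w. w \<in> hom A W K \<and> ?q \<cdot>\<^bsub>A\<^esub> w = u \<and> r \<cdot>\<^bsub>A\<^esub> w = v"
    if "W \<in> Obj A" "u \<in> hom A W (OMap G ?FX)" "v \<in> hom A W Y"
      "AMap G (AMap F f) \<cdot>\<^bsub>A\<^esub> u \<preceq>\<^bsub>A\<^esub> \<eta> Y \<cdot>\<^bsub>A\<^esub> v" for W u v
    using ex[OF that] uni[OF that(1)] by (auto intro!: ex_ex1I)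
  then show ?thesis
    unfolding is_comma_def doms using q r le ord
    by (intro exI[of _ K] conjI ballI impI) simp_all
qed

lemma comma_choice_exists:
  assumes pb: "has_pullbacks A" and cm: "has_comma_objects B"
  shows "\<exists>q R. comma_choice A F G \<eta> q R"
proof -
  have "\<exists>q r. is_comma A (AMap G (AMap F f)) (\<eta> (Cod A f)) q r" if arr: "f \<in> Arr A" for f
  proof -
    let ?Y = "Cod A f" and ?FY = "OMap F (Cod A f)"
    note f = F.A.arr_hom[OF arr]
    have Y: "?Y \<in> Obj A" using F.A.hom_objs[OF f] by blast
    then have FY: "?FY \<in> Obj B" by (rule F.map_obj)
    note Ff = F.map_hom[OF f] and idY = F.B.id_hom[OF FY]
    obtain p0 p1 where p: "is_comma B (AMap F f) (Idn B ?FY) p0 p1"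
      using cm F.B.hom_arr[OF Ff] F.B.hom_arr[OF idY] unfolding has_comma_objects_def by metis
    then obtain P where "p1 \<in> hom B P ?FY"
      using F.B.hom_arr[OF idY] unfolding is_comma_def by metis
    from G.map_hom[OF this] obtain a r where "is_pullback A (AMap G p1) (\<eta> ?Y) a r"
      using pb F.A.hom_arr F.A.hom_arr[OF eta_hom[OF Y]] unfolding has_pullbacks_def by metis
    from comma_exists[OF f p this] show ?thesis by blast
  qed
  then show ?thesis unfolding comma_choice_def by metis
qed

end

definition L_arr :: "('o, 'm) ordcat \<Rightarrow> ('o \<Rightarrow> 'm) \<Rightarrow> ('m \<Rightarrow> 'm) \<Rightarrow> ('m \<Rightarrow> 'm) \<Rightarrow> 'm \<Rightarrow> 'm" where
  "L_arr C \<eta> q R f =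
     (THE l. l \<in> hom C (Dom C f) (Dom C (q f)) \<and>
        q f \<cdot>\<^bsub>C\<^esub> l = \<eta> (Dom C f) \<and> R f \<cdot>\<^bsub>C\<^esub> l = f)"

text \<open>\<open>K\<close> on morphisms of the arrow category is induced by the universal property of \<open>Kg\<close>.\<close>

definition K_map :: "('o, 'm) ordcat \<Rightarrow> ('o, 'm, 'p, 'n) func \<Rightarrow> ('p, 'n, 'o, 'm) func \<Rightarrow>
    ('m \<Rightarrow> 'm) \<Rightarrow> ('m \<Rightarrow> 'm) \<Rightarrow> 'm square \<Rightarrow> 'm" where
  "K_map C S G q R = (\<lambda>(f, (h, k), g).
     (THE m. m \<in> hom C (Dom C (q f)) (Dom C (q g)) \<and>
        q g \<cdot>\<^bsub>C\<^esub> m = AMap G (AMap S h) \<cdot>\<^bsub>C\<^esub> q f \<and> R g \<cdot>\<^bsub>C\<^esub> m = k \<cdot>\<^bsub>C\<^esub> R f))"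

definition L_func :: "('o, 'm) ordcat \<Rightarrow> ('o, 'm, 'p, 'n) func \<Rightarrow> ('p, 'n, 'o, 'm) func \<Rightarrow>
    ('o \<Rightarrow> 'm) \<Rightarrow> ('m \<Rightarrow> 'm) \<Rightarrow> ('m \<Rightarrow> 'm) \<Rightarrow> ('m, 'm square, 'm, 'm square) func" where
  "L_func C S G \<eta> q R =
     \<lparr>OMap = L_arr C \<eta> q R,
      AMap = (\<lambda>(f, (h, k), g).
        (L_arr C \<eta> q R f, (h, K_map C S G q R (f, (h, k), g)), L_arr C \<eta> q R g))\<rparr>"

definition Phi :: "('o, 'm) ordcat \<Rightarrow> ('o \<Rightarrow> 'm) \<Rightarrow> ('m \<Rightarrow> 'm) \<Rightarrow> ('m \<Rightarrow> 'm) \<Rightarrow> 'm \<Rightarrow> 'm square" where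
  "Phi C \<eta> q R f = (L_arr C \<eta> q R f, (Idn C (Dom C f), R f), f)"

definition simple_adjunction :: "('o, 'm) ordcat \<Rightarrow> ('p, 'n) ordcat \<Rightarrow> ('o, 'm, 'p, 'n) func \<Rightarrow>
    ('o \<Rightarrow> 'm) \<Rightarrow> ('p \<Rightarrow> 'n) \<Rightarrow> ('m \<Rightarrow> 'm) \<Rightarrow> ('m \<Rightarrow> 'm) \<Rightarrow> bool" where
  "simple_adjunction C B S \<eta> \<epsilon> q R \<longleftrightarrow>
     (\<forall>f\<in>Arr C. is_embedding C B S (L_arr C \<eta> q R f)
        (\<epsilon> (OMap S (Dom C f)) \<cdot>\<^bsub>B\<^esub> AMap S (q f)))"

end

theory Submission
  imports Defs
begin

text \<open>A section \<open>s\<close> of \<open>Rf\<close> with \<open>s \<cdot> f = Lf\<close> and a right adjoint \<open>r\<close> exhibiting \<open>f\<close> as an \<open>S\<close>-embedding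
  determine each other: \<open>s\<close> is the morphism into the comma-object \<open>Kf\<close> with \<open>q\<^sub>f \<cdot> s = Gr \<cdot> \<eta>\<close> and
  \<open>Rf \<cdot> s = 1\<close>, and \<open>r\<close> is the transpose of \<open>q\<^sub>f \<cdot> s\<close>. So \<open>S\<close>-\<open>Emb\<close> is always the category of coalgebras
  of the copointed endofunctor \<open>(L, \<Phi>)\<close>. Simplicity says that \<open>Lf\<close> carries the embedding structure
  whose section \<open>\<sigma>\<^sub>f\<close> satisfies \<open>q\<^bsub>Lf\<^esub> \<cdot> \<sigma>\<^sub>f = q\<^sub>f\<close>; the \<open>(1, \<sigma>\<^sub>f)\<close> form a comultiplication with which every
  copointed coalgebra is compatible, and the cofree functor sends \<open>f\<close> to \<open>Lf\<close>. Conversely the two counit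
  laws of a comultiplication \<open>(1, \<sigma>\<^sub>f)\<close> say exactly that \<open>\<sigma>\<^sub>f\<close> is a section of \<open>R(Lf)\<close> with
  \<open>q\<^bsub>Lf\<^esub> \<cdot> \<sigma>\<^sub>f = q\<^sub>f\<close>, so that the corresponding right adjoint is the transpose of \<open>q\<^sub>f\<close>.\<close>

section \<open>Ord-categories of arrows, embeddings and coalgebras\<close>

context ord_category
begin

lemma id_arr [simp]: "X \<in> Obj C \<Longrightarrow> Idn C X \<in> Arr C"
  and dom_id [simp]: "X \<in> Obj C \<Longrightarrow> Dom C (Idn C X) = X"
  and cod_id [simp]: "X \<in> Obj C \<Longrightarrow> Cod C (Idn C X) = X"
  using id_hom[of X] by (auto simp: hom_def)

lemma
  assumes "f \<in> Arr C" "g \<in> Arr C" "Cod C f = Dom C g"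
  shows comp_arr [simp]: "g \<cdot> f \<in> Arr C"
    and dom_comp [simp]: "Dom C (g \<cdot> f) = Dom C f"
    and cod_comp [simp]: "Cod C (g \<cdot> f) = Cod C g"
  using comp_hom[of f "Dom C f" "Cod C f" g "Cod C g"] assms by (auto simp: hom_def)

lemma comp_id_arr [simp]: "f \<in> Arr C \<Longrightarrow> Dom C f = X \<Longrightarrow> f \<cdot> Idn C X = f"
  and id_comp_arr [simp]: "f \<in> Arr C \<Longrightarrow> Cod C f = X \<Longrightarrow> Idn C X \<cdot> f = f"
  using comp_id id_comp arr_hom by blast+

lemma comp_assoc_arr [simp]:
  "f \<in> Arr C \<Longrightarrow> g \<in> Arr C \<Longrightarrow> h \<in> Arr C \<Longrightarrow> Cod C f = Dom C g \<Longrightarrow> Cod C g = Dom C h \<Longrightarrow>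
    (h \<cdot> g) \<cdot> f = h \<cdot> (g \<cdot> f)"
  using comp_assoc[OF arr_hom[of f] _ arr_hom[of h]] by (auto simp: hom_def)

text \<open>Simplification associates composites to the right, so an equation for
  \<open>h \<cdot> g\<close> no longer matches inside \<open>h \<cdot> (g \<cdot> f)\<close>; this
  rule and the next restate it for that normal form.\<close>

lemma comp_reassoc:
  assumes "h \<cdot> g = k" "f \<in> Arr C" "g \<in> Arr C" "h \<in> Arr C" "Cod C f = Dom C g" "Cod C g = Dom C h"
  shows "h \<cdot> (g \<cdot> f) = k \<cdot> f"
  using comp_assoc_arr assms by metis

lemma comp_reassoc_square:
  assumes "h \<cdot> g = k \<cdot> l" "f \<in> Arr C" "g \<in> Arr C" "h \<in> Arr C" "k \<in> Arr C" "l \<in> Arr C"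
    "Cod C f = Dom C g" "Cod C g = Dom C h" "Cod C f = Dom C l" "Cod C l = Dom C k"
  shows "h \<cdot> (g \<cdot> f) = k \<cdot> (l \<cdot> f)"
  using comp_reassoc[OF assms(1)] assms by simp

text \<open>Two commutative squares are pasted along \<open>z\<close>; this closes squares and
  coalgebra morphisms under composition.\<close>

lemma comp_square_paste:
  assumes "z \<cdot> w = x \<cdot> y" "v \<cdot> p = u \<cdot> z"
    and "x \<in> Arr C" "y \<in> Arr C" "z \<in> Arr C" "w \<in> Arr C" "u \<in> Arr C" "v \<in> Arr C" "p \<in> Arr C"
    and "Cod C y = Dom C x" "Cod C w = Dom C z" "Cod C z = Dom C u" "Cod C x = Dom C u"
      "Cod C w = Dom C p" "Cod C p = Dom C v"
  shows "v \<cdot> (p \<cdot> w) = u \<cdot> (x \<cdot> y)"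
  using comp_reassoc_square[OF assms(2)] assms by simp

lemma leq_refl_arr [simp]: "f \<in> Arr C \<Longrightarrow> f \<preceq> f"
  using leq_refl arr_hom by blast

lemma comp_mono_arr:
  assumes "f \<preceq> f'" "g \<preceq> g'" "f \<in> Arr C" "f' \<in> Arr C" "g \<in> Arr C" "g' \<in> Arr C"
    "Dom C f = Dom C f'" "Cod C f = Cod C f'" "Dom C g = Dom C g'" "Cod C g = Cod C g'"
    "Cod C f = Dom C g"
  shows "g \<cdot> f \<preceq> g' \<cdot> f'"
  using comp_mono[of f "Dom C f" "Cod C f" f' g "Cod C g" g'] assms by (simp add: hom_def)

declare dom_obj [simp] cod_obj [simp]

end

context ord_functor
begin

declare map_obj [simp] map_id [simp]

lemma map_arr [simp]: "f \<in> Arr A \<Longrightarrow> AMap F f \<in> Arr B"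
  and dom_map [simp]: "f \<in> Arr A \<Longrightarrow> Dom B (AMap F f) = OMap F (Dom A f)"
  and cod_map [simp]: "f \<in> Arr A \<Longrightarrow> Cod B (AMap F f) = OMap F (Cod A f)"
  using map_hom[of f "Dom A f" "Cod A f"] by (auto simp: hom_def)

lemma map_comp_arr [simp]:
  "f \<in> Arr A \<Longrightarrow> g \<in> Arr A \<Longrightarrow> Cod A f = Dom A g \<Longrightarrow>
    AMap F (g \<cdot>\<^bsub>A\<^esub> f) = AMap F g \<cdot>\<^bsub>B\<^esub> AMap F f"
  using map_comp[of f "Dom A f" "Cod A f" g "Cod A g"] by (auto simp: hom_def)

lemma map_mono_arr:
  "f \<preceq>\<^bsub>A\<^esub> g \<Longrightarrow> f \<in> Arr A \<Longrightarrow> g \<in> Arr A \<Longrightarrow> Dom A f = Dom A g \<Longrightarrow> Cod A f = Cod A g \<Longrightarrow>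
    AMap F f \<preceq>\<^bsub>B\<^esub> AMap F g"
  using map_mono[of f "Dom A f" "Cod A f" g] by (auto simp: hom_def)

end

lemma (in ord_category) ord_functor_id: "ord_functor C C id_func"
  by unfold_locales (auto simp: id_func_def)

lemma ord_functor_comp:
  assumes "ord_functor A B F" "ord_functor B D G"
  shows "ord_functor A D (G \<circ>\<^sub>F F)"
proof -
  interpret F: ord_functor A B F by fact
  interpret G: ord_functor B D G by fact
  show ?thesis
    by unfold_locales
      (auto simp: comp_func_def hom_def intro!: G.map_mono_arr F.map_mono_arr)
qed

section \<open>Arrows, embeddings and coalgebras form Ord-categories\<close>

lemma (in ord_category) ord_category_arrow_cat: "ord_category (arrow_cat C)"
proof (unfold_locales, goal_cases)
  \<comment> \<open>Case 4 is closure under composition, cases 9 and 10 are antisymmetry and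
    transitivity; the same numbering recurs for \<open>Emb\<close> and
    \<open>coalgebras\<close>.\<close>
  case (4 f X Y g Z)
  then show ?case
    by (auto simp: arrow_cat_def hom_def) (erule (1) comp_square_paste; simp)
next
  case (9 f X Y g) then show ?case
    by (auto simp: arrow_cat_def hom_def intro: leq_antisym)
next
  case (10 f X Y g h) then show ?case
    by (auto simp: arrow_cat_def hom_def intro: leq_trans)
qed (auto simp: arrow_cat_def hom_def intro!: comp_mono_arr)

lemma (in ord_functor) ord_category_Emb: "ord_category (Emb A B F)"
proof (unfold_locales, goal_cases)
  \<comment> \<open>Two pastings: the underlying squares in \<open>A\<close>, and in
    \<open>B\<close> the squares expressing compatibility with the right adjoints.\<close>
  case (4 f X Y g Z)
  then show ?case
    apply (auto simp: arrow_cat_def hom_def Emb_def is_embedding_def)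
     apply (erule (1) A.comp_square_paste; simp)
    apply (erule B.comp_reassoc_square; simp)
    done
next
  case (9 f X Y g) then show ?case
    by (auto simp: arrow_cat_def hom_def Emb_def intro: A.leq_antisym)
next
  case (10 f X Y g h) then show ?case
    by (auto simp: arrow_cat_def hom_def Emb_def intro: A.leq_trans)
qed (auto simp: arrow_cat_def hom_def Emb_def is_embedding_def intro!: A.comp_mono_arr)

lemma (in ord_functor) ord_functor_Emb_forget: "ord_functor (Emb A B F) (arrow_cat A) Emb_forget"
proof -
  interpret E: ord_category "Emb A B F" by (rule ord_category_Emb)
  interpret D: ord_category "arrow_cat A" by (rule A.ord_category_arrow_cat)
  show ?thesis
    by unfold_locales (auto simp: Emb_forget_def arrow_cat_def hom_def Emb_def is_embedding_def)
qed

lemma (in ord_comonad) ord_category_coalgebras: "ord_category (coalgebras D W e d)"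
proof (unfold_locales, goal_cases)
  case (4 f X Y g Z)
  then show ?case
    by (auto simp: coalgebras_def hom_def)
      (erule (1) counit.F.A.comp_square_paste; simp)
next
  case (9 f X Y g) then show ?case
    by (auto simp: coalgebras_def hom_def intro: counit.F.A.leq_antisym)
next
  case (10 f X Y g h) then show ?case
    by (auto simp: coalgebras_def hom_def intro: counit.F.A.leq_trans)
qed (auto simp: coalgebras_def hom_def intro!: counit.F.A.comp_mono_arr)

lemma arrow_cat_simps:
  "Obj (arrow_cat C) = Arr C"
  "Dom (arrow_cat C) (f, hk, g) = f"
  "Cod (arrow_cat C) (f, hk, g) = g"
  "Idn (arrow_cat C) f = (f, (Idn C (Dom C f), Idn C (Cod C f)), f)"
  "(g, (h', k'), l) \<cdot>\<^bsub>arrow_cat C\<^esub> (f, (h, k), g') = (f, (h' \<cdot>\<^bsub>C\<^esub> h, k' \<cdot>\<^bsub>C\<^esub> k), l)"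
  "((f, (h, k), g) \<preceq>\<^bsub>arrow_cat C\<^esub> (f', (h', k'), g')) \<longleftrightarrow> h \<preceq>\<^bsub>C\<^esub> h' \<and> k \<preceq>\<^bsub>C\<^esub> k'"
  by (simp_all add: arrow_cat_def)

lemma Emb_simps:
  "(f, r) \<in> Obj (Emb C B S) \<longleftrightarrow> is_embedding C B S f r"
  "((f, r), (h, k), (g, t)) \<in> Arr (Emb C B S) \<longleftrightarrow>
     is_embedding C B S f r \<and> is_embedding C B S g t \<and> (f, (h, k), g) \<in> Arr (arrow_cat C) \<and>
     AMap S h \<cdot>\<^bsub>B\<^esub> r = t \<cdot>\<^bsub>B\<^esub> AMap S k"
  "Dom (Emb C B S) (x, hk, y) = x"
  "Cod (Emb C B S) (x, hk, y) = y"
  "Idn (Emb C B S) (f, r) = ((f, r), (Idn C (Dom C f), Idn C (Cod C f)), (f, r))"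
  "(y, (h', k'), z) \<cdot>\<^bsub>Emb C B S\<^esub> (x, (h, k), y') = (x, (h' \<cdot>\<^bsub>C\<^esub> h, k' \<cdot>\<^bsub>C\<^esub> k), z)"
  "((x, (h, k), y) \<preceq>\<^bsub>Emb C B S\<^esub> (x', (h', k'), y')) \<longleftrightarrow> h \<preceq>\<^bsub>C\<^esub> h' \<and> k \<preceq>\<^bsub>C\<^esub> k'"
  by (simp_all add: Emb_def)

lemma Emb_forget_simps: "OMap Emb_forget (f, r) = f"
  "AMap Emb_forget ((f, r), hk, (g, t)) = (f, hk, g)"
  by (simp_all add: Emb_forget_def)

lemma coalgebras_simps:
  "(X, a) \<in> Obj (coalgebras D W e d) \<longleftrightarrow>
     X \<in> Obj D \<and> a \<in> hom D X (OMap W X) \<and>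
     e X \<cdot>\<^bsub>D\<^esub> a = Idn D X \<and> d X \<cdot>\<^bsub>D\<^esub> a = AMap W a \<cdot>\<^bsub>D\<^esub> a"
  "((X, a), m, (Y, b)) \<in> Arr (coalgebras D W e d) \<longleftrightarrow>
     (X, a) \<in> Obj (coalgebras D W e d) \<and> (Y, b) \<in> Obj (coalgebras D W e d) \<and>
     m \<in> hom D X Y \<and> b \<cdot>\<^bsub>D\<^esub> m = AMap W m \<cdot>\<^bsub>D\<^esub> a"
  "Dom (coalgebras D W e d) (x, m, y) = x"
  "Cod (coalgebras D W e d) (x, m, y) = y"
  "Idn (coalgebras D W e d) (X, a) = ((X, a), Idn D X, (X, a))"
  "(y, n, z) \<cdot>\<^bsub>coalgebras D W e d\<^esub> (x, m, y') = (x, n \<cdot>\<^bsub>D\<^esub> m, z)"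
  "((x, m, y) \<preceq>\<^bsub>coalgebras D W e d\<^esub> (x', m', y')) \<longleftrightarrow> m \<preceq>\<^bsub>D\<^esub> m'"
  by (simp_all add: coalgebras_def)

context ord_adjunction
begin

lemma eta_arr [simp]: "X \<in> Obj A \<Longrightarrow> \<eta> X \<in> Arr A"
  and dom_eta [simp]: "X \<in> Obj A \<Longrightarrow> Dom A (\<eta> X) = X"
  and cod_eta [simp]: "X \<in> Obj A \<Longrightarrow> Cod A (\<eta> X) = OMap G (OMap F X)"
  using eta_hom[of X] by (auto simp: hom_def)

lemma eps_arr [simp]: "Z \<in> Obj B \<Longrightarrow> \<epsilon> Z \<in> Arr B"
  and dom_eps [simp]: "Z \<in> Obj B \<Longrightarrow> Dom B (\<epsilon> Z) = OMap F (OMap G Z)"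
  and cod_eps [simp]: "Z \<in> Obj B \<Longrightarrow> Cod B (\<epsilon> Z) = Z"
  using eps_hom[of Z] by (auto simp: hom_def)

lemma eta_nat_arr: "f \<in> Arr A \<Longrightarrow> AMap G (AMap F f) \<cdot>\<^bsub>A\<^esub> \<eta> (Dom A f) = \<eta> (Cod A f) \<cdot>\<^bsub>A\<^esub> f"
  using eta_nat F.A.arr_hom by blast

end

section \<open>The comma factorisation and sections of \<open>R\<close>\<close>

locale comma_factorisation = ord_adjunction C B S G \<eta> \<epsilon>
  for C :: "('o, 'm) ordcat" and B :: "('p, 'n) ordcat"
    and S :: "('o, 'm, 'p, 'n) func" and G :: "('p, 'n, 'o, 'm) func"
    and \<eta> :: "'o \<Rightarrow> 'm" and \<epsilon> :: "'p \<Rightarrow> 'n" +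
  fixes q R :: "'m \<Rightarrow> 'm"
  assumes choice: "comma_choice C S G \<eta> q R"
begin

abbreviation L :: "'m \<Rightarrow> 'm" where "L \<equiv> L_arr C \<eta> q R"
abbreviation K :: "'m \<Rightarrow> 'o" where "K f \<equiv> Dom C (q f)"
abbreviation K_mor :: "'m \<Rightarrow> 'm \<Rightarrow> 'm \<Rightarrow> 'm \<Rightarrow> 'm" where
  "K_mor f h k g \<equiv> K_map C S G q R (f, (h, k), g)"
abbreviation \<Phi> :: "'m \<Rightarrow> 'm square" where "\<Phi> \<equiv> Phi C \<eta> q R"
abbreviation \<L> :: "('m, 'm square, 'm, 'm square) func" where "\<L> \<equiv> L_func C S G \<eta> q R"

text \<open>The transpose of \<open>q f\<close> across the adjunction, hence the candidate right
  adjoint of \<open>S (L f)\<close> in the definition of simplicity.\<close>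

abbreviation q_hat :: "'m \<Rightarrow> 'n" where
  "q_hat f \<equiv> \<epsilon> (OMap S (Dom C f)) \<cdot>\<^bsub>B\<^esub> AMap S (q f)"

lemma comma:
  assumes "f \<in> Arr C"
  shows "is_comma C (AMap G (AMap S f)) (\<eta> (Cod C f)) (q f) (R f)"
  using choice assms by (simp add: comma_choice_def)

lemma
  assumes "f \<in> Arr C"
  shows q_arr [simp]: "q f \<in> Arr C"
    and cod_q [simp]: "Cod C (q f) = OMap G (OMap S (Dom C f))"
    and R_arr [simp]: "R f \<in> Arr C"
    and dom_R [simp]: "Dom C (R f) = K f"
    and cod_R [simp]: "Cod C (R f) = Cod C f"
    and comma_leq: "AMap G (AMap S f) \<cdot>\<^bsub>C\<^esub> q f \<preceq>\<^bsub>C\<^esub> \<eta> (Cod C f) \<cdot>\<^bsub>C\<^esub> R f"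
  using comma[OF assms] assms unfolding is_comma_def by (auto simp: hom_def)

lemma K_leqI:
  assumes "q f \<cdot>\<^bsub>C\<^esub> w \<preceq>\<^bsub>C\<^esub> q f \<cdot>\<^bsub>C\<^esub> w'" "R f \<cdot>\<^bsub>C\<^esub> w \<preceq>\<^bsub>C\<^esub> R f \<cdot>\<^bsub>C\<^esub> w'"
    and "f \<in> Arr C" "w \<in> Arr C" "w' \<in> Arr C" "Dom C w = Dom C w'" "Cod C w = K f" "Cod C w' = K f"
  shows "w \<preceq>\<^bsub>C\<^esub> w'"
proof -
  have "\<forall>W\<in>Obj C. \<forall>w\<in>hom C W (K f). \<forall>w'\<in>hom C W (K f).
      q f \<cdot>\<^bsub>C\<^esub> w \<preceq>\<^bsub>C\<^esub> q f \<cdot>\<^bsub>C\<^esub> w' \<and> R f \<cdot>\<^bsub>C\<^esub> w \<preceq>\<^bsub>C\<^esub> R f \<cdot>\<^bsub>C\<^esub> w' \<longrightarrow> w \<preceq>\<^bsub>C\<^esub> w'"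
    using comma[OF assms(3)] unfolding is_comma_def by (auto simp: hom_def)
  from this[rule_format, of "Dom C w'" w w'] show ?thesis using assms by (auto simp: hom_def)
qed

text \<open>The projections jointly reflect the order, so antisymmetry makes them jointly monic.
  Most equations below between morphisms into \<open>K f\<close> are checked this way.\<close>

lemma K_eqI:
  assumes "q f \<cdot>\<^bsub>C\<^esub> w = q f \<cdot>\<^bsub>C\<^esub> w'" "R f \<cdot>\<^bsub>C\<^esub> w = R f \<cdot>\<^bsub>C\<^esub> w'"
    and "f \<in> Arr C" "w \<in> Arr C" "w' \<in> Arr C" "Dom C w = Dom C w'" "Cod C w = K f" "Cod C w' = K f"
  shows "w = w'"
proof (rule F.A.leq_antisym)
  show "w \<preceq>\<^bsub>C\<^esub> w'" "w' \<preceq>\<^bsub>C\<^esub> w" by (rule K_leqI[of f]; use assms in simp)+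
qed (use assms in \<open>auto simp: hom_def\<close>)

lemma K_unique:
  assumes "AMap G (AMap S f) \<cdot>\<^bsub>C\<^esub> u \<preceq>\<^bsub>C\<^esub> \<eta> (Cod C f) \<cdot>\<^bsub>C\<^esub> v"
    and "f \<in> Arr C" "u \<in> Arr C" "v \<in> Arr C" "Dom C u = W" "Dom C v = W"
      "Cod C u = OMap G (OMap S (Dom C f))" "Cod C v = Cod C f"
  shows "\<exists>!w. w \<in> hom C W (K f) \<and> q f \<cdot>\<^bsub>C\<^esub> w = u \<and> R f \<cdot>\<^bsub>C\<^esub> w = v"
proof -
  have "\<forall>W\<in>Obj C. \<forall>u\<in>hom C W (OMap G (OMap S (Dom C f))). \<forall>v\<in>hom C W (Cod C f).
      AMap G (AMap S f) \<cdot>\<^bsub>C\<^esub> u \<preceq>\<^bsub>C\<^esub> \<eta> (Cod C f) \<cdot>\<^bsub>C\<^esub> v \<longrightarrow>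
      (\<exists>!w. w \<in> hom C W (K f) \<and> q f \<cdot>\<^bsub>C\<^esub> w = u \<and> R f \<cdot>\<^bsub>C\<^esub> w = v)"
    using comma[OF assms(2)] assms(2) unfolding is_comma_def by (auto simp: hom_def)
  moreover have "W \<in> Obj C" "u \<in> hom C W (OMap G (OMap S (Dom C f)))" "v \<in> hom C W (Cod C f)"
    using assms F.A.dom_obj[of u] by (simp_all add: hom_def)
  ultimately show ?thesis using assms(1) by blast
qed

text \<open>Naturality of \<open>\<eta>\<close> makes \<open>\<eta> (Dom C f)\<close> and
  \<open>f\<close> a cone, with equality where the comma-object only asks for an inequality.\<close>

lemma
  assumes f: "f \<in> Arr C"
  shows L_arr [simp]: "L f \<in> Arr C"
    and dom_L [simp]: "Dom C (L f) = Dom C f"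
    and cod_L [simp]: "Cod C (L f) = K f"
    and q_L: "q f \<cdot>\<^bsub>C\<^esub> L f = \<eta> (Dom C f)"
    and R_L: "R f \<cdot>\<^bsub>C\<^esub> L f = f"
proof -
  have "\<exists>!l. l \<in> hom C (Dom C f) (K f) \<and> q f \<cdot>\<^bsub>C\<^esub> l = \<eta> (Dom C f) \<and> R f \<cdot>\<^bsub>C\<^esub> l = f"
    by (rule K_unique) (use f in \<open>simp_all add: eta_nat_arr\<close>)
  from theI'[OF this, folded L_arr_def]
  show "L f \<in> Arr C" "Dom C (L f) = Dom C f" "Cod C (L f) = K f"
    "q f \<cdot>\<^bsub>C\<^esub> L f = \<eta> (Dom C f)" "R f \<cdot>\<^bsub>C\<^esub> L f = f"
    by (auto simp: hom_def)
qed

section \<open>Functoriality of \<open>L\<close>\<close>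

lemma square_iff:
  "(f, (h, k), g) \<in> Arr (arrow_cat C) \<longleftrightarrow>
     f \<in> Arr C \<and> g \<in> Arr C \<and> h \<in> Arr C \<and> k \<in> Arr C \<and>
     Dom C h = Dom C f \<and> Cod C h = Dom C g \<and> Dom C k = Cod C f \<and> Cod C k = Cod C g \<and>
     g \<cdot>\<^bsub>C\<^esub> h = k \<cdot>\<^bsub>C\<^esub> f"
  by (auto simp: arrow_cat_def hom_def)

text \<open>The comma inequality of \<open>f\<close>, composed with \<open>GSk\<close>, becomes a
  cone over \<open>g\<close> by commutativity of the square and naturality of
  \<open>\<eta>\<close>.\<close>

lemma
  assumes "(f, (h, k), g) \<in> Arr (arrow_cat C)"
  shows K_mor_arr [simp]: "K_mor f h k g \<in> Arr C"
    and dom_K_mor [simp]: "Dom C (K_mor f h k g) = K f"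
    and cod_K_mor [simp]: "Cod C (K_mor f h k g) = K g"
    and q_K_mor: "q g \<cdot>\<^bsub>C\<^esub> K_mor f h k g = AMap G (AMap S h) \<cdot>\<^bsub>C\<^esub> q f"
    and R_K_mor: "R g \<cdot>\<^bsub>C\<^esub> K_mor f h k g = k \<cdot>\<^bsub>C\<^esub> R f"
proof -
  from assms have arrs [simp]: "f \<in> Arr C" "g \<in> Arr C" "h \<in> Arr C" "k \<in> Arr C"
      "Dom C h = Dom C f" "Cod C h = Dom C g" "Dom C k = Cod C f" "Cod C k = Cod C g"
    and sq: "g \<cdot>\<^bsub>C\<^esub> h = k \<cdot>\<^bsub>C\<^esub> f"
    unfolding square_iff by blast+
  have "AMap G (AMap S g) \<cdot>\<^bsub>C\<^esub> (AMap G (AMap S h) \<cdot>\<^bsub>C\<^esub> q f) =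
      AMap G (AMap S (g \<cdot>\<^bsub>C\<^esub> h)) \<cdot>\<^bsub>C\<^esub> q f"
    by simp
  also have "\<dots> = AMap G (AMap S k) \<cdot>\<^bsub>C\<^esub> (AMap G (AMap S f) \<cdot>\<^bsub>C\<^esub> q f)"
    by (simp add: sq)
  also have "\<dots> \<preceq>\<^bsub>C\<^esub> AMap G (AMap S k) \<cdot>\<^bsub>C\<^esub> (\<eta> (Cod C f) \<cdot>\<^bsub>C\<^esub> R f)"
    by (rule F.A.comp_mono_arr[OF comma_leq]) simp_all
  also have "\<dots> = \<eta> (Cod C g) \<cdot>\<^bsub>C\<^esub> (k \<cdot>\<^bsub>C\<^esub> R f)"
    by (rule F.A.comp_reassoc_square) (use eta_nat_arr[of k] in simp_all)
  finally have "\<exists>!m. m \<in> hom C (K f) (K g) \<and>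
      q g \<cdot>\<^bsub>C\<^esub> m = AMap G (AMap S h) \<cdot>\<^bsub>C\<^esub> q f \<and> R g \<cdot>\<^bsub>C\<^esub> m = k \<cdot>\<^bsub>C\<^esub> R f"
    by (intro K_unique) simp_all
  from theI'[OF this]
  show "K_mor f h k g \<in> Arr C" "Dom C (K_mor f h k g) = K f" "Cod C (K_mor f h k g) = K g"
    "q g \<cdot>\<^bsub>C\<^esub> K_mor f h k g = AMap G (AMap S h) \<cdot>\<^bsub>C\<^esub> q f"
    "R g \<cdot>\<^bsub>C\<^esub> K_mor f h k g = k \<cdot>\<^bsub>C\<^esub> R f"
    by (auto simp: hom_def K_map_def)
qed

text \<open>After the projections of \<open>K g\<close>, both composites become
  \<open>\<eta> \<cdot> h\<close>, by naturality of \<open>\<eta>\<close>, and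
  \<open>g \<cdot> h = k \<cdot> f\<close>.\<close>

lemma L_square:
  assumes "(f, (h, k), g) \<in> Arr (arrow_cat C)"
  shows "(L f, (h, K_mor f h k g), L g) \<in> Arr (arrow_cat C)"
proof -
  note [simp] = assms[unfolded square_iff]
  have "L g \<cdot>\<^bsub>C\<^esub> h = K_mor f h k g \<cdot>\<^bsub>C\<^esub> L f"
  proof (rule K_eqI[of g])
    show "q g \<cdot>\<^bsub>C\<^esub> L g \<cdot>\<^bsub>C\<^esub> h = q g \<cdot>\<^bsub>C\<^esub> K_mor f h k g \<cdot>\<^bsub>C\<^esub> L f"
      using F.A.comp_reassoc[OF q_L[of g], of h] F.A.comp_reassoc_square[OF q_K_mor[OF assms], of "L f"]
        eta_nat_arr[of h] by (simp add: assms q_L)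
    show "R g \<cdot>\<^bsub>C\<^esub> L g \<cdot>\<^bsub>C\<^esub> h = R g \<cdot>\<^bsub>C\<^esub> K_mor f h k g \<cdot>\<^bsub>C\<^esub> L f"
      using F.A.comp_reassoc[OF R_L[of g], of h] F.A.comp_reassoc_square[OF R_K_mor[OF assms], of "L f"]
      by (simp add: assms R_L)
  qed (simp_all add: assms)
  then show ?thesis by (simp add: square_iff assms)
qed

lemma Phi_square: "f \<in> Arr C \<Longrightarrow> (L f, (Idn C (Dom C f), R f), f) \<in> Arr (arrow_cat C)"
  by (simp add: square_iff R_L)

lemma K_mor_id:
  assumes "f \<in> Arr C"
  shows "K_mor f (Idn C (Dom C f)) (Idn C (Cod C f)) f = Idn C (K f)"
proof -
  have sq: "(f, (Idn C (Dom C f), Idn C (Cod C f)), f) \<in> Arr (arrow_cat C)"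
    using assms by (simp add: square_iff)
  show ?thesis
    by (rule K_eqI[of f]) (use assms q_K_mor[OF sq] R_K_mor[OF sq] in \<open>simp_all add: sq\<close>)
qed

lemma square_comp:
  assumes "(f, (h, k), g) \<in> Arr (arrow_cat C)" "(g, (h', k'), l) \<in> Arr (arrow_cat C)"
  shows "(f, (h' \<cdot>\<^bsub>C\<^esub> h, k' \<cdot>\<^bsub>C\<^esub> k), l) \<in> Arr (arrow_cat C)"
  using assms F.A.comp_square_paste[of g h k f l h' k'] by (simp add: square_iff)

lemma K_mor_comp:
  assumes sq: "(f, (h, k), g) \<in> Arr (arrow_cat C)" and sq': "(g, (h', k'), l) \<in> Arr (arrow_cat C)"
  shows "K_mor f (h' \<cdot>\<^bsub>C\<^esub> h) (k' \<cdot>\<^bsub>C\<^esub> k) l = K_mor g h' k' l \<cdot>\<^bsub>C\<^esub> K_mor f h k g"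
proof (rule K_eqI[of l])
  note sq'' = square_comp[OF sq sq']
  have arrs [simp]: "f \<in> Arr C" "g \<in> Arr C" "l \<in> Arr C" "h \<in> Arr C" "k \<in> Arr C" "h' \<in> Arr C" "k' \<in> Arr C"
    "Dom C h = Dom C f" "Cod C h = Dom C g" "Dom C k = Cod C f" "Cod C k = Cod C g"
    "Dom C h' = Dom C g" "Cod C h' = Dom C l" "Dom C k' = Cod C g" "Cod C k' = Cod C l"
    using sq sq' unfolding square_iff by simp_all
  show "q l \<cdot>\<^bsub>C\<^esub> K_mor f (h' \<cdot>\<^bsub>C\<^esub> h) (k' \<cdot>\<^bsub>C\<^esub> k) l =
      q l \<cdot>\<^bsub>C\<^esub> K_mor g h' k' l \<cdot>\<^bsub>C\<^esub> K_mor f h k g"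
    using F.A.comp_reassoc_square[OF q_K_mor[OF sq'], of "K_mor f h k g"]
    by (simp add: q_K_mor[OF sq''] q_K_mor[OF sq] sq sq')
  show "R l \<cdot>\<^bsub>C\<^esub> K_mor f (h' \<cdot>\<^bsub>C\<^esub> h) (k' \<cdot>\<^bsub>C\<^esub> k) l =
      R l \<cdot>\<^bsub>C\<^esub> K_mor g h' k' l \<cdot>\<^bsub>C\<^esub> K_mor f h k g"
    using F.A.comp_reassoc_square[OF R_K_mor[OF sq'], of "K_mor f h k g"]
    by (simp add: R_K_mor[OF sq''] R_K_mor[OF sq] sq sq')
  show "l \<in> Arr C" by simp
qed (simp_all add: sq sq' square_comp[OF sq sq'])

lemma K_mor_mono:
  assumes sq: "(f, (h, k), g) \<in> Arr (arrow_cat C)" and sq': "(f, (h', k'), g) \<in> Arr (arrow_cat C)"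
    and leq: "h \<preceq>\<^bsub>C\<^esub> h'" "k \<preceq>\<^bsub>C\<^esub> k'"
  shows "K_mor f h k g \<preceq>\<^bsub>C\<^esub> K_mor f h' k' g"
proof (rule K_leqI[of g])
  have arrs [simp]: "f \<in> Arr C" "g \<in> Arr C" "h \<in> Arr C" "k \<in> Arr C" "h' \<in> Arr C" "k' \<in> Arr C"
    "Dom C h = Dom C f" "Cod C h = Dom C g" "Dom C k = Cod C f" "Cod C k = Cod C g"
    "Dom C h' = Dom C f" "Cod C h' = Dom C g" "Dom C k' = Cod C f" "Cod C k' = Cod C g"
    using sq sq' unfolding square_iff by simp_all
  show "q g \<cdot>\<^bsub>C\<^esub> K_mor f h k g \<preceq>\<^bsub>C\<^esub> q g \<cdot>\<^bsub>C\<^esub> K_mor f h' k' g"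
    unfolding q_K_mor[OF sq] q_K_mor[OF sq']
    by (rule F.A.comp_mono_arr; simp?) (intro G.map_mono_arr F.map_mono_arr leq; simp)
  show "R g \<cdot>\<^bsub>C\<^esub> K_mor f h k g \<preceq>\<^bsub>C\<^esub> R g \<cdot>\<^bsub>C\<^esub> K_mor f h' k' g"
    unfolding R_K_mor[OF sq] R_K_mor[OF sq']
    by (rule F.A.comp_mono_arr; simp add: leq)
  show "g \<in> Arr C" by simp
qed (simp_all add: sq sq')

lemma L_func_simps [simp]:
  "OMap \<L> f = L f" "AMap \<L> (f, (h, k), g) = (L f, (h, K_mor f h k g), L g)"
  by (simp_all add: L_func_def)

lemma L_functor: "ord_functor (arrow_cat C) (arrow_cat C) \<L>"
proof -
  interpret D: ord_category "arrow_cat C" by (rule F.A.ord_category_arrow_cat)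
  show ?thesis
    by unfold_locales
      (auto simp: hom_def arrow_cat_simps L_square K_mor_id K_mor_comp K_mor_mono)
qed

section \<open>The transpose of \<open>q f\<close>\<close>

text \<open>Since \<open>q f \<cdot> L f\<close> is the unit, this is a triangle identity. Only the
  inequality half of simplicity is thus a genuine condition on the adjunction.\<close>

lemma q_hat_L: "f \<in> Arr C \<Longrightarrow> q_hat f \<cdot>\<^bsub>B\<^esub> AMap S (L f) = Idn B (OMap S (Dom C f))"
  using arg_cong[OF q_L[of f], of "AMap S"] by (simp add: triangle_left)

text \<open>Transposing the comma inequality of \<open>K f\<close>: transposition is monotone, sends
  \<open>GSf \<cdot> q f\<close> to the left side and \<open>\<eta> \<cdot> R f\<close> to
  \<open>S (R f)\<close>.\<close>

lemma comp_q_hat_leq: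
  assumes "f \<in> Arr C"
  shows "AMap S f \<cdot>\<^bsub>B\<^esub> q_hat f \<preceq>\<^bsub>B\<^esub> AMap S (R f)"
proof -
  note [simp] = assms
  have "AMap S f \<cdot>\<^bsub>B\<^esub> q_hat f = \<epsilon> (OMap S (Cod C f)) \<cdot>\<^bsub>B\<^esub> AMap S (AMap G (AMap S f) \<cdot>\<^bsub>C\<^esub> q f)"
    by (rule transpose_comp[of _ "K f"]) (simp_all add: hom_def)
  also have "\<dots> \<preceq>\<^bsub>B\<^esub> \<epsilon> (OMap S (Cod C f)) \<cdot>\<^bsub>B\<^esub> AMap S (\<eta> (Cod C f) \<cdot>\<^bsub>C\<^esub> R f)"
    by (rule transpose_mono[of _ "K f"]) (simp_all add: hom_def comma_leq)
  also have "\<dots> = AMap S (R f)"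
    by (rule transpose_unit[of _ "K f"]) (simp add: hom_def)
  finally show ?thesis .
qed

text \<open>The transpose of the equation \<open>q_K_mor\<close>.\<close>

lemma q_hat_natural:
  assumes "(f, (h, k), g) \<in> Arr (arrow_cat C)"
  shows "AMap S h \<cdot>\<^bsub>B\<^esub> q_hat f = q_hat g \<cdot>\<^bsub>B\<^esub> AMap S (K_mor f h k g)"
proof -
  note [simp] = assms[unfolded square_iff]
  have "AMap S h \<cdot>\<^bsub>B\<^esub> q_hat f = \<epsilon> (OMap S (Dom C g)) \<cdot>\<^bsub>B\<^esub> AMap S (AMap G (AMap S h) \<cdot>\<^bsub>C\<^esub> q f)"
    by (rule transpose_comp[of _ "K f"]) (simp_all add: hom_def)
  then show ?thesis unfolding q_K_mor[OF assms, symmetric] by (simp add: assms)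
qed

lemma transpose_q_hat:
  assumes "f \<in> Arr C" "s \<in> Arr C" "Cod C s = K f"
  shows "AMap G (q_hat f \<cdot>\<^bsub>B\<^esub> AMap S s) \<cdot>\<^bsub>C\<^esub> \<eta> (Dom C s) = q f \<cdot>\<^bsub>C\<^esub> s"
  using transpose_back[of "q f \<cdot>\<^bsub>C\<^esub> s" "Dom C s" "OMap S (Dom C f)"] assms by (simp add: hom_def)

text \<open>The round trip opposite to \<open>transpose_back\<close>, by naturality of
  \<open>\<epsilon>\<close> and a triangle identity.\<close>

lemma transpose_comp_unit:
  assumes "r \<in> hom B (OMap S Y) Z"
    and "Y \<in> Obj C"
  shows "\<epsilon> Z \<cdot>\<^bsub>B\<^esub> AMap S (AMap G r \<cdot>\<^bsub>C\<^esub> \<eta> Y) = r"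
  using transpose_comp[OF eta_hom[OF assms(2)] assms(1)] triangle_left[OF assms(2)]
    F.B.comp_id[OF assms(1)] by simp

section \<open>Right adjoints as sections of \<open>R f\<close>\<close>

definition emb_section :: "'m \<Rightarrow> 'n \<Rightarrow> 'm" where
  "emb_section f r = (THE s. s \<in> hom C (Cod C f) (K f) \<and>
     q f \<cdot>\<^bsub>C\<^esub> s = AMap G r \<cdot>\<^bsub>C\<^esub> \<eta> (Cod C f) \<and> R f \<cdot>\<^bsub>C\<^esub> s = Idn C (Cod C f))"

abbreviation emb :: "'m \<Rightarrow> 'n \<Rightarrow> bool" where "emb \<equiv> is_embedding C B S"

lemma
  assumes "emb f r"
  shows emb_arr: "f \<in> Arr C"
    and emb_adj_arr: "r \<in> Arr B"
    and dom_emb_adj: "Dom B r = OMap S (Cod C f)"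
    and cod_emb_adj: "Cod B r = OMap S (Dom C f)"
    and emb_adj_comp: "r \<cdot>\<^bsub>B\<^esub> AMap S f = Idn B (OMap S (Dom C f))"
    and emb_comp_adj: "AMap S f \<cdot>\<^bsub>B\<^esub> r \<preceq>\<^bsub>B\<^esub> Idn B (OMap S (Cod C f))"
  using assms by (auto simp: is_embedding_def hom_def)

text \<open>The inequality \<open>Sf \<cdot> r \<le> 1\<close>, under \<open>G\<close> and
  precomposed with \<open>\<eta>\<close>, is the cone condition for \<open>Gr \<cdot> \<eta>\<close>
  and the identity.\<close>

lemma
  assumes emb: "emb f r"
  shows emb_section_arr [simp]: "emb_section f r \<in> Arr C"
    and dom_emb_section [simp]: "Dom C (emb_section f r) = Cod C f"
    and cod_emb_section [simp]: "Cod C (emb_section f r) = K f"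
    and q_emb_section: "q f \<cdot>\<^bsub>C\<^esub> emb_section f r = AMap G r \<cdot>\<^bsub>C\<^esub> \<eta> (Cod C f)"
    and R_emb_section: "R f \<cdot>\<^bsub>C\<^esub> emb_section f r = Idn C (Cod C f)"
proof -
  note [simp] = emb_arr[OF emb] emb_adj_arr[OF emb] dom_emb_adj[OF emb] cod_emb_adj[OF emb]
  have "AMap G (AMap S f) \<cdot>\<^bsub>C\<^esub> (AMap G r \<cdot>\<^bsub>C\<^esub> \<eta> (Cod C f)) =
      AMap G (AMap S f \<cdot>\<^bsub>B\<^esub> r) \<cdot>\<^bsub>C\<^esub> \<eta> (Cod C f)"
    by simp
  also have "\<dots> \<preceq>\<^bsub>C\<^esub> AMap G (Idn B (OMap S (Cod C f))) \<cdot>\<^bsub>C\<^esub> \<eta> (Cod C f)"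
    using G.map_mono_arr[OF emb_comp_adj[OF emb]] by (intro F.A.comp_mono_arr) simp_all
  also have "\<dots> = \<eta> (Cod C f) \<cdot>\<^bsub>C\<^esub> Idn C (Cod C f)" by simp
  finally have "\<exists>!s. s \<in> hom C (Cod C f) (K f) \<and>
      q f \<cdot>\<^bsub>C\<^esub> s = AMap G r \<cdot>\<^bsub>C\<^esub> \<eta> (Cod C f) \<and> R f \<cdot>\<^bsub>C\<^esub> s = Idn C (Cod C f)"
    by (intro K_unique) simp_all
  from theI'[OF this, folded emb_section_def]
  show "emb_section f r \<in> Arr C" "Dom C (emb_section f r) = Cod C f" "Cod C (emb_section f r) = K f"
    "q f \<cdot>\<^bsub>C\<^esub> emb_section f r = AMap G r \<cdot>\<^bsub>C\<^esub> \<eta> (Cod C f)"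
    "R f \<cdot>\<^bsub>C\<^esub> emb_section f r = Idn C (Cod C f)"
    by (auto simp: hom_def)
qed

text \<open>Here \<open>r \<cdot> Sf = 1\<close> enters: by naturality of \<open>\<eta>\<close>,
  \<open>q f\<close> sends the left side to \<open>G (r \<cdot> Sf) \<cdot> \<eta>\<close>, which is
  the unit.\<close>

lemma emb_section_comp:
  assumes emb: "emb f r"
  shows "emb_section f r \<cdot>\<^bsub>C\<^esub> f = L f"
proof (rule K_eqI[of f])
  note [simp] = emb_arr[OF emb] emb_adj_arr[OF emb] dom_emb_adj[OF emb] cod_emb_adj[OF emb]
  have "q f \<cdot>\<^bsub>C\<^esub> emb_section f r \<cdot>\<^bsub>C\<^esub> f = AMap G r \<cdot>\<^bsub>C\<^esub> \<eta> (Cod C f) \<cdot>\<^bsub>C\<^esub> f"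
    by (rule F.A.comp_reassoc_square[OF q_emb_section[OF emb]]) (simp_all add: emb)
  also have "\<dots> = AMap G (r \<cdot>\<^bsub>B\<^esub> AMap S f) \<cdot>\<^bsub>C\<^esub> \<eta> (Dom C f)"
    using eta_nat_arr[of f] by simp
  finally show "q f \<cdot>\<^bsub>C\<^esub> emb_section f r \<cdot>\<^bsub>C\<^esub> f = q f \<cdot>\<^bsub>C\<^esub> L f"
    unfolding emb_adj_comp[OF emb] by (simp add: q_L)
  show "R f \<cdot>\<^bsub>C\<^esub> emb_section f r \<cdot>\<^bsub>C\<^esub> f = R f \<cdot>\<^bsub>C\<^esub> L f"
    using F.A.comp_reassoc[OF R_emb_section[OF emb], of f] by (simp add: emb R_L)
qed (simp_all add: emb emb_arr[OF emb])

lemma emb_section_square: "emb f r \<Longrightarrow> (f, (Idn C (Dom C f), emb_section f r), L f) \<in> Arr (arrow_cat C)"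
  using emb_arr[of f r] by (simp add: square_iff emb_section_comp)

text \<open>The left side is the transpose of \<open>q f\<close> composed with the section, that is
  of \<open>Gr \<cdot> \<eta>\<close>. So \<open>r\<close> is recovered from its section.\<close>

lemma q_hat_emb_section:
  assumes emb: "emb f r"
  shows "q_hat f \<cdot>\<^bsub>B\<^esub> AMap S (emb_section f r) = r"
  using transpose_comp_unit[of r "Cod C f" "OMap S (Dom C f)"] emb_arr[OF emb] emb_adj_arr[OF emb]
    dom_emb_adj[OF emb] cod_emb_adj[OF emb] arg_cong[OF q_emb_section[OF emb], of "AMap S"]
  by (simp add: emb hom_def)

text \<open>The retraction law is \<open>q_hat_L\<close> rewritten by
  \<open>s \<cdot> f = L f\<close>. The inequality is \<open>comp_q_hat_leq\<close> composed with
  \<open>S s\<close>, where \<open>S (R f) \<cdot> S s\<close> is the identity. The section is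
  recovered because it has the same two projections as \<open>s\<close>.\<close>

lemma
  assumes s: "s \<in> Arr C" "Dom C s = Cod C f" "Cod C s = K f" and f: "f \<in> Arr C"
    and Rs: "R f \<cdot>\<^bsub>C\<^esub> s = Idn C (Cod C f)" and sf: "s \<cdot>\<^bsub>C\<^esub> f = L f"
  shows emb_of_section: "emb f (q_hat f \<cdot>\<^bsub>B\<^esub> AMap S s)"
    and emb_section_of_section: "emb_section f (q_hat f \<cdot>\<^bsub>B\<^esub> AMap S s) = s"
proof -
  note [simp] = s f
  have "q_hat f \<cdot>\<^bsub>B\<^esub> (AMap S s \<cdot>\<^bsub>B\<^esub> AMap S f) = Idn B (OMap S (Dom C f))"
    using q_hat_L[OF f] F.map_comp_arr[of f s] sf by simp
  moreover have "(AMap S f \<cdot>\<^bsub>B\<^esub> q_hat f) \<cdot>\<^bsub>B\<^esub> AMap S s \<preceq>\<^bsub>B\<^esub> AMap S (R f) \<cdot>\<^bsub>B\<^esub> AMap S s"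
    by (rule F.B.comp_mono_arr) (simp_all add: comp_q_hat_leq)
  moreover have "AMap S (R f) \<cdot>\<^bsub>B\<^esub> AMap S s = Idn B (OMap S (Cod C f))"
    using arg_cong[OF Rs, of "AMap S"] by simp
  ultimately show emb: "emb f (q_hat f \<cdot>\<^bsub>B\<^esub> AMap S s)"
    by (simp add: is_embedding_def hom_def)
  \<comment> \<open>The composite under \<open>G\<close> must stay unexpanded for
    \<open>transpose_q_hat\<close> to match, hence the deleted rules.\<close>
  show "emb_section f (q_hat f \<cdot>\<^bsub>B\<^esub> AMap S s) = s"
    by (rule K_eqI[of f])
      (use transpose_q_hat[OF f s(1) s(3)] in
        \<open>simp_all add: q_emb_section[OF emb] R_emb_section[OF emb] emb Rs
           del: G.map_comp_arr F.B.comp_assoc_arr\<close>)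
qed

text \<open>Forwards, both sides are compared after the projections of \<open>K g\<close>.
  Backwards, \<open>S\<close> followed by \<open>q_hat g\<close> turns sections into adjoints, by
  naturality of \<open>q_hat\<close>. The correspondence of adjoints and sections thereby extends to
  morphisms.\<close>

lemma emb_mor_iff:
  assumes emb: "emb f r" "emb g t" and sq: "(f, (h, k), g) \<in> Arr (arrow_cat C)"
  shows "AMap S h \<cdot>\<^bsub>B\<^esub> r = t \<cdot>\<^bsub>B\<^esub> AMap S k \<longleftrightarrow>
    K_mor f h k g \<cdot>\<^bsub>C\<^esub> emb_section f r = emb_section g t \<cdot>\<^bsub>C\<^esub> k"
proof
  note [simp] = emb_adj_arr[OF emb(1)] dom_emb_adj[OF emb(1)] cod_emb_adj[OF emb(1)]
    emb_adj_arr[OF emb(2)] dom_emb_adj[OF emb(2)] cod_emb_adj[OF emb(2)]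
  have arrs [simp]: "f \<in> Arr C" "g \<in> Arr C" "h \<in> Arr C" "k \<in> Arr C"
    "Dom C h = Dom C f" "Cod C h = Dom C g" "Dom C k = Cod C f" "Cod C k = Cod C g"
    using sq unfolding square_iff by simp_all
  show "K_mor f h k g \<cdot>\<^bsub>C\<^esub> emb_section f r = emb_section g t \<cdot>\<^bsub>C\<^esub> k"
    if eq: "AMap S h \<cdot>\<^bsub>B\<^esub> r = t \<cdot>\<^bsub>B\<^esub> AMap S k"
  proof (rule K_eqI[of g])
    have "AMap G (AMap S h) \<cdot>\<^bsub>C\<^esub> AMap G r \<cdot>\<^bsub>C\<^esub> \<eta> (Cod C f) =
        AMap G (AMap S h \<cdot>\<^bsub>B\<^esub> r) \<cdot>\<^bsub>C\<^esub> \<eta> (Cod C f)"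
      by simp
    also have "\<dots> = AMap G t \<cdot>\<^bsub>C\<^esub> \<eta> (Cod C g) \<cdot>\<^bsub>C\<^esub> k"
      using eta_nat_arr[of k] by (simp add: eq)
    finally show "q g \<cdot>\<^bsub>C\<^esub> K_mor f h k g \<cdot>\<^bsub>C\<^esub> emb_section f r = q g \<cdot>\<^bsub>C\<^esub> emb_section g t \<cdot>\<^bsub>C\<^esub> k"
      using F.A.comp_reassoc_square[OF q_K_mor[OF sq], of "emb_section f r"]
        F.A.comp_reassoc_square[OF q_emb_section[OF emb(2)], of k]
      by (simp add: emb sq q_emb_section[OF emb(1)])
    show "R g \<cdot>\<^bsub>C\<^esub> K_mor f h k g \<cdot>\<^bsub>C\<^esub> emb_section f r = R g \<cdot>\<^bsub>C\<^esub> emb_section g t \<cdot>\<^bsub>C\<^esub> k"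
      using F.A.comp_reassoc_square[OF R_K_mor[OF sq], of "emb_section f r"]
        F.A.comp_reassoc[OF R_emb_section[OF emb(2)], of k]
      by (simp add: emb sq R_emb_section[OF emb(1)])
  qed (simp_all add: emb sq)
  show "AMap S h \<cdot>\<^bsub>B\<^esub> r = t \<cdot>\<^bsub>B\<^esub> AMap S k"
    if eq: "K_mor f h k g \<cdot>\<^bsub>C\<^esub> emb_section f r = emb_section g t \<cdot>\<^bsub>C\<^esub> k"
  proof -
    have "AMap S h \<cdot>\<^bsub>B\<^esub> r = (AMap S h \<cdot>\<^bsub>B\<^esub> q_hat f) \<cdot>\<^bsub>B\<^esub> AMap S (emb_section f r)"
      using q_hat_emb_section[OF emb(1)] by (simp add: emb)
    also have "\<dots> = q_hat g \<cdot>\<^bsub>B\<^esub> AMap S (K_mor f h k g \<cdot>\<^bsub>C\<^esub> emb_section f r)"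
      unfolding q_hat_natural[OF sq] by (simp add: emb sq)
    also have "\<dots> = (q_hat g \<cdot>\<^bsub>B\<^esub> AMap S (emb_section g t)) \<cdot>\<^bsub>B\<^esub> AMap S k"
      unfolding eq by (simp add: emb)
    also have "\<dots> = t \<cdot>\<^bsub>B\<^esub> AMap S k" unfolding q_hat_emb_section[OF emb(2)] ..
    finally show ?thesis .
  qed
qed

section \<open>Simplicity and the counit laws\<close>

text \<open>Transposing \<open>q_hat f\<close> back returns \<open>q f\<close>; this is the first
  component of the second counit law.\<close>

lemma q_emb_section_L:
  assumes "f \<in> Arr C" and emb: "emb (L f) (q_hat f)"
  shows "q (L f) \<cdot>\<^bsub>C\<^esub> emb_section (L f) (q_hat f) = q f"
  using q_emb_section[OF emb] transpose_q_hat[OF assms(1), of "Idn C (K f)"] assms(1) by simp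

text \<open>The counit laws make \<open>m\<close> of the form \<open>(1, s)\<close> with
  \<open>s\<close> a section of \<open>R (L f)\<close> whose associated adjoint is
  \<open>q_hat f\<close>. Stating this for a single square \<open>m\<close> covers both a
  comultiplication and the forgetful image of the unit of an adjunction.\<close>

lemma emb_L_of_counital:
  assumes f: "f \<in> Arr C" and m: "m \<in> hom (arrow_cat C) (L f) (L (L f))"
    and left: "\<Phi> (L f) \<cdot>\<^bsub>arrow_cat C\<^esub> m = Idn (arrow_cat C) (L f)"
    and right: "AMap \<L> (\<Phi> f) \<cdot>\<^bsub>arrow_cat C\<^esub> m = Idn (arrow_cat C) (L f)"
  shows "emb (L f) (q_hat f)"
proof -
  note [simp] = f
  obtain h s where m': "m = (L f, (h, s), L (L f))" "(L f, (h, s), L (L f)) \<in> Arr (arrow_cat C)"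
    using m by (cases m) (auto simp: hom_def arrow_cat_simps)
  note PhiS = Phi_square[OF f]
  from m'(2) have s [simp]: "s \<in> Arr C" "Dom C s = K f" "Cod C s = K (L f)" "h \<in> Arr C"
      "Dom C h = Dom C f" "Cod C h = Dom C f"
    and sq: "L (L f) \<cdot>\<^bsub>C\<^esub> h = s \<cdot>\<^bsub>C\<^esub> L f"
    by (simp_all add: square_iff)
  from left have h: "h = Idn C (Dom C f)" and Rs: "R (L f) \<cdot>\<^bsub>C\<^esub> s = Idn C (K f)"
    by (simp_all add: m' Phi_def arrow_cat_simps)
  from right have Ks: "K_mor (L f) (Idn C (Dom C f)) (R f) f \<cdot>\<^bsub>C\<^esub> s = Idn C (K f)"
    by (simp add: m' Phi_def arrow_cat_simps)
  \<comment> \<open>Composing the second counit law with \<open>q f\<close> isolates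
    \<open>q (L f) \<cdot> s\<close>, since \<open>GS\<close> preserves the identity.\<close>
  have "q f \<cdot>\<^bsub>C\<^esub> K_mor (L f) (Idn C (Dom C f)) (R f) f \<cdot>\<^bsub>C\<^esub> s =
      AMap G (AMap S (Idn C (Dom C f))) \<cdot>\<^bsub>C\<^esub> q (L f) \<cdot>\<^bsub>C\<^esub> s"
    by (rule F.A.comp_reassoc_square[OF q_K_mor[OF PhiS]]) (simp_all add: PhiS)
  then have "q (L f) \<cdot>\<^bsub>C\<^esub> s = q f" unfolding Ks by simp
  then have "q_hat (L f) \<cdot>\<^bsub>B\<^esub> AMap S s = q_hat f"
    using F.map_comp_arr[of s "q (L f)"] by simp
  moreover have "emb (L f) (q_hat (L f) \<cdot>\<^bsub>B\<^esub> AMap S s)"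
    by (rule emb_of_section) (use Rs sq h in simp_all)
  ultimately show ?thesis by simp
qed

lemma simple_iff:
  "simple_adjunction C B S \<eta> \<epsilon> q R \<longleftrightarrow> (\<forall>f\<in>Arr C. emb (L f) (q_hat f))"
  by (simp add: simple_adjunction_def)

lemma Phi_nat_trans: "nat_trans (arrow_cat C) (arrow_cat C) \<L> id_func \<Phi>"
proof -
  interpret D: ord_category "arrow_cat C" by (rule F.A.ord_category_arrow_cat)
  interpret L: ord_functor "arrow_cat C" "arrow_cat C" \<L> by (rule L_functor)
  interpret I: ord_functor "arrow_cat C" "arrow_cat C" id_func by (rule D.ord_functor_id)
  show ?thesis
  proof
    fix f assume "f \<in> Obj (arrow_cat C)"
    then show "\<Phi> f \<in> hom (arrow_cat C) (OMap \<L> f) (OMap id_func f)"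
      by (simp add: hom_def arrow_cat_simps Phi_def Phi_square id_func_def)
  next
    fix m f g assume m: "m \<in> hom (arrow_cat C) f g"
    then obtain h k where m: "m = (f, (h, k), g)" "(f, (h, k), g) \<in> Arr (arrow_cat C)"
      by (cases m) (auto simp: hom_def arrow_cat_simps)
    then show "AMap id_func m \<cdot>\<^bsub>arrow_cat C\<^esub> \<Phi> f = \<Phi> g \<cdot>\<^bsub>arrow_cat C\<^esub> AMap \<L> m"
      using R_K_mor[OF m(2)] by (simp add: Phi_def arrow_cat_simps id_func_def square_iff)
  qed
qed

definition coalg_of :: "'m \<Rightarrow> 'n \<Rightarrow> 'm square" where
  "coalg_of f r = (f, (Idn C (Dom C f), emb_section f r), L f)"

text \<open>The projections pick out the codomain component \<open>s\<close> of a square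
  \<open>(f, (h, s), L f)\<close>, which is then transposed.\<close>

definition adj_of :: "'m \<Rightarrow> 'm square \<Rightarrow> 'n" where
  "adj_of f a = q_hat f \<cdot>\<^bsub>B\<^esub> AMap S (snd (fst (snd a)))"

lemma adj_of_coalg_of [simp]: "emb f r \<Longrightarrow> adj_of f (coalg_of f r) = r"
  by (simp add: adj_of_def coalg_of_def q_hat_emb_section)

lemma simple_of_comonad:
  assumes "ord_comonad (arrow_cat C) \<L> \<Phi> \<Sigma>"
  shows "simple_adjunction C B S \<eta> \<epsilon> q R"
proof -
  interpret comonad: ord_comonad "arrow_cat C" \<L> \<Phi> \<Sigma> by fact
  show ?thesis unfolding simple_iff
  proof
    fix f assume f: "f \<in> Arr C"
    then have "f \<in> Obj (arrow_cat C)" by (simp add: arrow_cat_simps)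
    with f show "emb (L f) (q_hat f)"
      using comonad.comult.component[of f] comonad.counit_left[of f] comonad.counit_right[of f]
      by (intro emb_L_of_counital) (simp_all add: comp_func_def)
  qed
qed

text \<open>The comultiplication of the induced comonad is the forgetful image of the unit at
  \<open>T f\<close>. As \<open>T\<close> lies over \<open>\<L>\<close> and the counit is
  \<open>\<Phi>\<close>, the triangle identities become the two counit laws.\<close>

lemma simple_of_adjunction:
  assumes adj: "ord_adjunction (Emb C B S) (arrow_cat C) Emb_forget T \<nu> \<xi>"
    and eq: "func_eq (arrow_cat C) (Emb_forget \<circ>\<^sub>F T) \<L>"
    and \<xi>: "\<And>f. f \<in> Obj (arrow_cat C) \<Longrightarrow> \<xi> f = \<Phi> f"
  shows "simple_adjunction C B S \<eta> \<epsilon> q R"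
  unfolding simple_iff
proof
  interpret adj: ord_adjunction "Emb C B S" "arrow_cat C" Emb_forget T \<nu> \<xi> by fact
  interpret L: ord_functor "arrow_cat C" "arrow_cat C" \<L> by (rule L_functor)
  fix f assume f: "f \<in> Arr C"
  let ?x = "OMap T f" and ?m = "AMap Emb_forget (\<nu> (OMap T f))"
  have fD: "f \<in> Obj (arrow_cat C)" using f by (simp add: arrow_cat_simps)
  have x: "?x \<in> Obj (Emb C B S)" using fD by (rule adj.G.map_obj)
  have UT: "OMap Emb_forget (OMap T g) = L g" if "g \<in> Arr C" for g
    using eq that by (simp add: func_eq_def comp_func_def arrow_cat_simps)
  have UTm: "AMap Emb_forget (AMap T m) = AMap \<L> m" if "m \<in> Arr (arrow_cat C)" for m
    using eq that by (simp add: func_eq_def comp_func_def)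
  show "emb (L f) (q_hat f)"
  proof (rule emb_L_of_counital[OF f])
    show "?m \<in> hom (arrow_cat C) (L f) (L (L f))"
      using adj.F.map_hom[OF adj.eta_hom[OF x]] f by (simp add: UT)
    show "\<Phi> (L f) \<cdot>\<^bsub>arrow_cat C\<^esub> ?m = Idn (arrow_cat C) (L f)"
      using adj.triangle_left[OF x] f by (simp add: UT \<xi> arrow_cat_simps(1))
    have \<xi>f: "\<xi> f \<in> Arr (arrow_cat C)" using adj.eps_arr[OF fD] .
    \<comment> \<open>This triangle identity lives in \<open>Emb C B S\<close> and has to be pushed
      down along the forgetful functor.\<close>
    have "AMap Emb_forget (AMap T (\<xi> f) \<cdot>\<^bsub>Emb C B S\<^esub> \<nu> ?x) = Idn (arrow_cat C) (L f)"
      using adj.triangle_right[OF fD] x f by (simp add: UT)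
    moreover have "AMap Emb_forget (AMap T (\<xi> f) \<cdot>\<^bsub>Emb C B S\<^esub> \<nu> ?x) =
        AMap Emb_forget (AMap T (\<xi> f)) \<cdot>\<^bsub>arrow_cat C\<^esub> ?m"
      by (rule adj.F.map_comp_arr) (use x fD in simp_all)
    ultimately show "AMap \<L> (\<Phi> f) \<cdot>\<^bsub>arrow_cat C\<^esub> ?m = Idn (arrow_cat C) (L f)"
      using UTm[OF \<xi>f] \<xi>[OF fD] by simp
  qed
qed

end

section \<open>Simple adjunctions\<close>

locale simple_comma_factorisation = comma_factorisation C B S G \<eta> \<epsilon> q R
  for C :: "('o, 'm) ordcat" and B :: "('p, 'n) ordcat"
    and S :: "('o, 'm, 'p, 'n) func" and G :: "('p, 'n, 'o, 'm) func"
    and \<eta> :: "'o \<Rightarrow> 'm" and \<epsilon> :: "'p \<Rightarrow> 'n"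
    and q R :: "'m \<Rightarrow> 'm" +
  assumes simple: "f \<in> Arr C \<Longrightarrow> emb (L f) (q_hat f)"
begin

section \<open>The comultiplication\<close>

abbreviation \<Sigma> :: "'m \<Rightarrow> 'm square" where
  "\<Sigma> f \<equiv> coalg_of (L f) (q_hat f)"

lemma L_emb_mor:
  "(f, (h, k), g) \<in> Arr (arrow_cat C) \<Longrightarrow>
    ((L f, q_hat f), (h, K_mor f h k g), (L g, q_hat g)) \<in> Arr (Emb C B S)"
  by (frule iffD1[OF square_iff]) (simp add: Emb_simps(2) simple L_square q_hat_natural)

text \<open>With identity domain component, compatibility of the adjoints reduces to
  \<open>q_hat_emb_section\<close>. These morphisms form the unit of the adjunction.\<close>

lemma unit_emb_mor:
  assumes "emb f r"
  shows "((f, r), (Idn C (Dom C f), emb_section f r), (L f, q_hat f)) \<in> Arr (Emb C B S)"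
  using assms emb_arr[OF assms] emb_adj_arr[OF assms] cod_emb_adj[OF assms] q_hat_emb_section[OF assms]
  by (simp add: Emb_simps simple emb_section_square)

text \<open>Applied to \<open>L_emb_mor\<close> it gives naturality of \<open>\<Sigma>\<close>;
  applied to \<open>unit_emb_mor\<close>, coassociativity and the compatibility of coalgebra
  structures with \<open>\<Sigma>\<close>.\<close>

lemma emb_mor_emb_section:
  assumes "((f, r), (h, k), (g, t)) \<in> Arr (Emb C B S)"
  shows "K_mor f h k g \<cdot>\<^bsub>C\<^esub> emb_section f r = emb_section g t \<cdot>\<^bsub>C\<^esub> k"
  using assms emb_mor_iff by (auto simp: Emb_simps)

text \<open>Under \<open>q f\<close> this is \<open>q_emb_section_L\<close>; under
  \<open>R f\<close> it holds because \<open>R (L f)\<close> is split by the section.\<close>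

lemma K_mor_counit_emb_section:
  assumes f: "f \<in> Arr C"
  shows "K_mor (L f) (Idn C (Dom C f)) (R f) f \<cdot>\<^bsub>C\<^esub> emb_section (L f) (q_hat f) = Idn C (K f)"
proof (rule K_eqI[of f])
  note [simp] = f simple[OF f] Phi_square[OF f]
  show "q f \<cdot>\<^bsub>C\<^esub> K_mor (L f) (Idn C (Dom C f)) (R f) f \<cdot>\<^bsub>C\<^esub> emb_section (L f) (q_hat f) =
      q f \<cdot>\<^bsub>C\<^esub> Idn C (K f)"
    using F.A.comp_reassoc_square[OF q_K_mor[OF Phi_square[OF f]], of "emb_section (L f) (q_hat f)"]
    by (simp add: q_emb_section_L)
  show "R f \<cdot>\<^bsub>C\<^esub> K_mor (L f) (Idn C (Dom C f)) (R f) f \<cdot>\<^bsub>C\<^esub> emb_section (L f) (q_hat f) =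
      R f \<cdot>\<^bsub>C\<^esub> Idn C (K f)"
    using F.A.comp_reassoc_square[OF R_K_mor[OF Phi_square[OF f]], of "emb_section (L f) (q_hat f)"]
    by (simp add: R_emb_section)
qed (simp_all add: f simple Phi_square)

lemma L_comonad: "ord_comonad (arrow_cat C) \<L> \<Phi> \<Sigma>"
proof -
  interpret D: ord_category "arrow_cat C" by (rule F.A.ord_category_arrow_cat)
  interpret counit: nat_trans "arrow_cat C" "arrow_cat C" \<L> id_func \<Phi> by (rule Phi_nat_trans)
  interpret LL: ord_functor "arrow_cat C" "arrow_cat C" "\<L> \<circ>\<^sub>F \<L>"
    by (rule ord_functor_comp[OF L_functor L_functor])
  interpret comult: nat_trans "arrow_cat C" "arrow_cat C" \<L> "\<L> \<circ>\<^sub>F \<L>" \<Sigma>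
  proof
    fix f assume "f \<in> Obj (arrow_cat C)"
    then show "\<Sigma> f \<in> hom (arrow_cat C) (OMap \<L> f) (OMap (\<L> \<circ>\<^sub>F \<L>) f)"
      using emb_section_square[OF simple, of f]
      by (simp add: hom_def arrow_cat_simps coalg_of_def comp_func_def)
  next
    fix m f g assume m: "m \<in> hom (arrow_cat C) f g"
    then obtain h k where m: "m = (f, (h, k), g)" "(f, (h, k), g) \<in> Arr (arrow_cat C)"
      by (cases m) (auto simp: hom_def arrow_cat_simps)
    then show "AMap (\<L> \<circ>\<^sub>F \<L>) m \<cdot>\<^bsub>arrow_cat C\<^esub> \<Sigma> f = \<Sigma> g \<cdot>\<^bsub>arrow_cat C\<^esub> AMap \<L> m"
      using emb_mor_emb_section[OF L_emb_mor[OF m(2)]]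
      by (simp add: coalg_of_def arrow_cat_simps comp_func_def square_iff)
  qed
  show ?thesis
  proof
    fix f assume "f \<in> Obj (arrow_cat C)"
    then have f [simp]: "f \<in> Arr C" by (simp add: arrow_cat_simps)
    note emb [simp] = simple[OF f]
    show "\<Phi> (OMap \<L> f) \<cdot>\<^bsub>arrow_cat C\<^esub> \<Sigma> f = Idn (arrow_cat C) (OMap \<L> f)"
      by (simp add: arrow_cat_simps Phi_def coalg_of_def R_emb_section)
    show "AMap \<L> (\<Phi> f) \<cdot>\<^bsub>arrow_cat C\<^esub> \<Sigma> f = Idn (arrow_cat C) (OMap \<L> f)"
      by (simp add: arrow_cat_simps Phi_def coalg_of_def K_mor_counit_emb_section)
    \<comment> \<open>The unit at the embedding \<open>L f\<close> is a morphism of embeddings, so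
      it commutes with the sections.\<close>
    show "\<Sigma> (OMap \<L> f) \<cdot>\<^bsub>arrow_cat C\<^esub> \<Sigma> f = AMap \<L> (\<Sigma> f) \<cdot>\<^bsub>arrow_cat C\<^esub> \<Sigma> f"
      using emb_mor_emb_section[OF unit_emb_mor[OF emb]]
      by (simp add: arrow_cat_simps coalg_of_def)
  qed
qed

section \<open>Coalgebras as embeddings\<close>

abbreviation coalg :: "('m \<times> 'm square, ('m \<times> 'm square) \<times> 'm square \<times> ('m \<times> 'm square)) ordcat" where
  "coalg \<equiv> coalgebras (arrow_cat C) \<L> \<Phi> \<Sigma>"

text \<open>The counit law forces the structure to be \<open>(1, s)\<close> with \<open>s\<close> a
  section of \<open>R f\<close> and \<open>s \<cdot> f = L f\<close>, so it comes from a right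
  adjoint. Conversely \<open>(1, s)\<close> is a morphism of embeddings into \<open>L f\<close>,
  which makes it compatible with \<open>\<Sigma>\<close>.\<close>

lemma coalg_obj_iff: "(f, a) \<in> Obj coalg \<longleftrightarrow> (\<exists>r. emb f r \<and> a = coalg_of f r)"
proof
  assume "\<exists>r. emb f r \<and> a = coalg_of f r"
  then obtain r where emb [simp]: "emb f r" and a: "a = coalg_of f r" by blast
  note [simp] = emb_arr[OF emb] emb_section_square[OF emb]
  show "(f, a) \<in> Obj coalg"
    using emb_mor_emb_section[OF unit_emb_mor[OF emb]]
    by (simp add: coalgebras_simps hom_def arrow_cat_simps a coalg_of_def Phi_def R_emb_section)
next
  assume fa: "(f, a) \<in> Obj coalg"
  then have f [simp]: "f \<in> Arr C" and a: "a \<in> hom (arrow_cat C) f (L f)"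
    and counit: "\<Phi> f \<cdot>\<^bsub>arrow_cat C\<^esub> a = Idn (arrow_cat C) f"
    by (simp_all add: coalgebras_simps arrow_cat_simps)
  obtain h s where a: "a = (f, (h, s), L f)" "(f, (h, s), L f) \<in> Arr (arrow_cat C)"
    using a by (cases a) (auto simp: hom_def arrow_cat_simps)
  from a(2) have s [simp]: "s \<in> Arr C" "Dom C s = Cod C f" "Cod C s = K f" "h \<in> Arr C" "Dom C h = Dom C f"
      "Cod C h = Dom C f"
    and sq: "L f \<cdot>\<^bsub>C\<^esub> h = s \<cdot>\<^bsub>C\<^esub> f"
    by (simp_all add: square_iff)
  from counit have h: "h = Idn C (Dom C f)" and Rs: "R f \<cdot>\<^bsub>C\<^esub> s = Idn C (Cod C f)"
    by (simp_all add: a Phi_def arrow_cat_simps)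
  have sf: "s \<cdot>\<^bsub>C\<^esub> f = L f" using sq h by simp
  show "\<exists>r. emb f r \<and> a = coalg_of f r"
    using emb_of_section[OF s(1-3) f Rs sf] emb_section_of_section[OF s(1-3) f Rs sf] a h
    by (auto simp: coalg_of_def)
qed

lemma coalg_objI: "emb f r \<Longrightarrow> (f, coalg_of f r) \<in> Obj coalg"
  using coalg_obj_iff by blast

text \<open>The coalgebra equation is trivial in the domain component and is the right side of
  \<open>emb_mor_iff\<close> in the codomain component.\<close>

lemma coalg_arr_iff:
  assumes "emb f r" "emb g t"
  shows "((f, coalg_of f r), (f, (h, k), g), (g, coalg_of g t)) \<in> Arr coalg \<longleftrightarrow>
    (f, (h, k), g) \<in> Arr (arrow_cat C) \<and> AMap S h \<cdot>\<^bsub>B\<^esub> r = t \<cdot>\<^bsub>B\<^esub> AMap S k"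
  using assms emb_mor_iff[OF assms, of h k] emb_arr[OF assms(1)] emb_arr[OF assms(2)]
  by (auto simp: coalgebras_simps(2) coalg_obj_iff hom_def)
    (auto simp: coalg_of_def arrow_cat_simps square_iff)

lemma coalg_objE:
  assumes "x \<in> Obj coalg"
  obtains f r where "x = (f, coalg_of f r)" "emb f r"
  using assms coalg_obj_iff by (cases x) auto

lemma coalg_arrE:
  assumes "x \<in> Arr coalg"
  obtains f r h k g t where "x = ((f, coalg_of f r), (f, (h, k), g), (g, coalg_of g t))"
    "emb f r" "emb g t" "(f, (h, k), g) \<in> Arr (arrow_cat C)" "AMap S h \<cdot>\<^bsub>B\<^esub> r = t \<cdot>\<^bsub>B\<^esub> AMap S k"
proof -
  obtain f a m g b where x: "x = ((f, a), m, (g, b))" by (metis prod.exhaust)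
  with assms have *: "(f, a) \<in> Obj coalg" "(g, b) \<in> Obj coalg" "m \<in> hom (arrow_cat C) f g"
    by (simp_all add: coalgebras_simps(2))
  then obtain r t h k where abm: "a = coalg_of f r" "b = coalg_of g t" "m = (f, (h, k), g)"
    and emb: "emb f r" "emb g t"
    unfolding coalg_obj_iff by (cases m) (auto simp: hom_def arrow_cat_simps)
  from assms show thesis
    unfolding x abm coalg_arr_iff[OF emb] using that[OF _ emb] x abm by blast
qed

lemma Emb_arrE:
  assumes "x \<in> Arr (Emb C B S)"
  obtains f r h k g t where "x = ((f, r), (h, k), (g, t))"
    "emb f r" "emb g t" "(f, (h, k), g) \<in> Arr (arrow_cat C)" "AMap S h \<cdot>\<^bsub>B\<^esub> r = t \<cdot>\<^bsub>B\<^esub> AMap S k"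
proof -
  obtain f r h k g t where x: "x = ((f, r), (h, k), (g, t))" by (metis prod.exhaust)
  with assms that show thesis by (simp add: Emb_simps)
qed

lemma coalg_forget_iso: "iso_over (Emb C B S) Emb_forget coalg coalgebras_forget"
proof -
  interpret comonad: ord_comonad "arrow_cat C" \<L> \<Phi> \<Sigma> by (rule L_comonad)
  interpret E: ord_category "Emb C B S" by (rule F.ord_category_Emb)
  interpret A: ord_category coalg by (rule comonad.ord_category_coalgebras)
  define J :: "('m \<times> 'n, ('m, 'n) emb_arrow, 'm \<times> 'm square,
      ('m \<times> 'm square) \<times> 'm square \<times> ('m \<times> 'm square)) func"
    where "J = \<lparr>OMap = \<lambda>(f, r). (f, coalg_of f r),
    AMap = \<lambda>((f, r), hk, (g, t)). ((f, coalg_of f r), (f, hk, g), (g, coalg_of g t))\<rparr>"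
  \<comment> \<open>The inverse transposes sections back to adjoints; \<open>fst (snd m)\<close> is
    the pair \<open>(h, k)\<close> of the square.\<close>
  define J' :: "('m \<times> 'm square,
      ('m \<times> 'm square) \<times> 'm square \<times> ('m \<times> 'm square), 'm \<times> 'n, ('m, 'n) emb_arrow) func"
    where "J' = \<lparr>OMap = \<lambda>(f, a). (f, adj_of f a),
    AMap = \<lambda>((f, a), m, (g, b)). ((f, adj_of f a), fst (snd m), (g, adj_of g b))\<rparr>"
  have J: "OMap J (f, r) = (f, coalg_of f r)"
    "AMap J ((f, r), hk, (g, t)) = ((f, coalg_of f r), (f, hk, g), (g, coalg_of g t))" for f r hk g t
    by (simp_all add: J_def)
  \<comment> \<open>These equations determine \<open>J'\<close> on all of \<open>coalg\<close>, as
    each of its objects comes from an embedding.\<close>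
  have J': "emb f r \<Longrightarrow> OMap J' (f, coalg_of f r) = (f, r)"
    "emb f r \<Longrightarrow> emb g t \<Longrightarrow>
      AMap J' ((f, coalg_of f r), (f, hk, g), (g, coalg_of g t)) = ((f, r), hk, (g, t))" for f r hk g t
    by (simp_all add: J'_def)
  have "ord_functor (Emb C B S) coalg J"
    by unfold_locales
      (auto elim!: Emb_arrE
        simp: hom_def J Emb_simps coalg_objI coalg_arr_iff coalgebras_simps(3-) arrow_cat_simps)
  moreover have "ord_functor coalg (Emb C B S) J'"
    by unfold_locales
      (auto elim!: coalg_arrE coalg_objE
        simp: hom_def J' Emb_simps coalgebras_simps(3-) arrow_cat_simps)
  moreover have "func_eq (Emb C B S) (J' \<circ>\<^sub>F J) id_func"
    by (auto elim!: Emb_arrE simp: func_eq_def comp_func_def id_func_def J J' Emb_simps(1))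
  moreover have "func_eq coalg (J \<circ>\<^sub>F J') id_func"
    by (auto elim!: coalg_arrE coalg_objE simp: func_eq_def comp_func_def id_func_def J J')
  moreover have "func_eq (Emb C B S) (coalgebras_forget \<circ>\<^sub>F J) Emb_forget"
    by (auto elim!: Emb_arrE simp: func_eq_def comp_func_def coalgebras_forget_def Emb_forget_def J)
  ultimately show ?thesis unfolding iso_over_def by blast
qed

section \<open>The cofree embedding\<close>

definition cofree_emb :: "('m, 'm square, 'm \<times> 'n, ('m, 'n) emb_arrow) func" where
  "cofree_emb = \<lparr>OMap = \<lambda>f. (L f, q_hat f),
    AMap = \<lambda>(f, (h, k), g). ((L f, q_hat f), (h, K_mor f h k g), (L g, q_hat g))\<rparr>"

definition cofree_unit :: "'m \<times> 'n \<Rightarrow> ('m, 'n) emb_arrow" where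
  "cofree_unit = (\<lambda>(f, r). ((f, r), (Idn C (Dom C f), emb_section f r), (L f, q_hat f)))"

lemma cofree_emb_simps: "OMap cofree_emb f = (L f, q_hat f)"
  "AMap cofree_emb (f, (h, k), g) = ((L f, q_hat f), (h, K_mor f h k g), (L g, q_hat g))"
  by (simp_all add: cofree_emb_def)

text \<open>Naturality of the unit is compatibility of morphisms with sections. One triangle
  identity says that the section splits \<open>R f\<close>, the other is
  \<open>K_mor_counit_emb_section\<close>.\<close>

lemma Emb_forget_adjunction:
  "ord_adjunction (Emb C B S) (arrow_cat C) Emb_forget cofree_emb cofree_unit \<Phi>"
proof -
  interpret D: ord_category "arrow_cat C" by (rule F.A.ord_category_arrow_cat)
  interpret E: ord_category "Emb C B S" by (rule F.ord_category_Emb)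
  interpret U: ord_functor "Emb C B S" "arrow_cat C" Emb_forget by (rule F.ord_functor_Emb_forget)
  interpret L: ord_functor "arrow_cat C" "arrow_cat C" \<L> by (rule L_functor)
  interpret cofree_emb: ord_functor "arrow_cat C" "Emb C B S" cofree_emb
    by unfold_locales
      (auto simp: hom_def cofree_emb_simps arrow_cat_simps Emb_simps(1,3-)
        L_emb_mor simple K_mor_id K_mor_comp K_mor_mono)
  interpret TU: ord_functor "Emb C B S" "Emb C B S" "cofree_emb \<circ>\<^sub>F Emb_forget"
    by (rule ord_functor_comp[OF U.ord_functor_axioms cofree_emb.ord_functor_axioms])
  interpret UT: ord_functor "arrow_cat C" "arrow_cat C" "Emb_forget \<circ>\<^sub>F cofree_emb"
    by (rule ord_functor_comp[OF cofree_emb.ord_functor_axioms U.ord_functor_axioms])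
  interpret IE: ord_functor "Emb C B S" "Emb C B S" id_func by (rule E.ord_functor_id)
  interpret Phi: nat_trans "arrow_cat C" "arrow_cat C" \<L> id_func \<Phi> by (rule Phi_nat_trans)
  interpret unit: nat_trans "Emb C B S" "Emb C B S" id_func "cofree_emb \<circ>\<^sub>F Emb_forget" cofree_unit
  proof
    fix x assume "x \<in> Obj (Emb C B S)"
    then show "cofree_unit x \<in> hom (Emb C B S) (OMap id_func x) (OMap (cofree_emb \<circ>\<^sub>F Emb_forget) x)"
      by (cases x) (simp add: Emb_simps(1,3-) hom_def cofree_unit_def id_func_def
          comp_func_def cofree_emb_simps Emb_forget_simps unit_emb_mor)
  next
    fix m x y assume "m \<in> hom (Emb C B S) x y"
    then obtain f r h k g t where m: "m = ((f, r), (h, k), (g, t))" "x = (f, r)" "y = (g, t)"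
      and mE: "((f, r), (h, k), (g, t)) \<in> Arr (Emb C B S)"
      by (cases m, cases x) (auto simp: hom_def Emb_simps(3,4))
    then have "(f, (h, k), g) \<in> Arr (arrow_cat C)" by (simp add: Emb_simps)
    then show "AMap (cofree_emb \<circ>\<^sub>F Emb_forget) m \<cdot>\<^bsub>Emb C B S\<^esub> cofree_unit x =
        cofree_unit y \<cdot>\<^bsub>Emb C B S\<^esub> AMap id_func m"
      using emb_mor_emb_section[OF mE]
      by (simp add: m cofree_unit_def id_func_def comp_func_def cofree_emb_simps Emb_forget_simps
          Emb_simps(6) square_iff)
  qed
  interpret counit: nat_trans "arrow_cat C" "arrow_cat C" "Emb_forget \<circ>\<^sub>F cofree_emb" id_func \<Phi>
  proof
    fix f assume "f \<in> Obj (arrow_cat C)"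
    then show "\<Phi> f \<in> hom (arrow_cat C) (OMap (Emb_forget \<circ>\<^sub>F cofree_emb) f) (OMap id_func f)"
      using Phi.component[of f] by (simp add: comp_func_def id_func_def cofree_emb_simps Emb_forget_simps)
  next
    fix m f g assume m: "m \<in> hom (arrow_cat C) f g"
    obtain f' h k g' where "m = (f', (h, k), g')" by (metis prod.exhaust)
    then show "AMap id_func m \<cdot>\<^bsub>arrow_cat C\<^esub> \<Phi> f =
        \<Phi> g \<cdot>\<^bsub>arrow_cat C\<^esub> AMap (Emb_forget \<circ>\<^sub>F cofree_emb) m"
      using Phi.naturality[OF m]
      by (simp add: comp_func_def id_func_def cofree_emb_simps Emb_forget_simps)
  qed
  show ?thesis
  proof
    fix x assume "x \<in> Obj (Emb C B S)"
    then obtain f r where x: "x = (f, r)" and emb [simp]: "emb f r" by (cases x) (auto simp: Emb_simps)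
    show "\<Phi> (OMap Emb_forget x) \<cdot>\<^bsub>arrow_cat C\<^esub> AMap Emb_forget (cofree_unit x) =
        Idn (arrow_cat C) (OMap Emb_forget x)"
      using emb_arr[OF emb]
      by (simp add: x Emb_forget_simps cofree_unit_def Phi_def arrow_cat_simps R_emb_section)
  next
    fix f assume "f \<in> Obj (arrow_cat C)"
    then have f [simp]: "f \<in> Arr C" by (simp add: arrow_cat_simps)
    show "AMap cofree_emb (\<Phi> f) \<cdot>\<^bsub>Emb C B S\<^esub> cofree_unit (OMap cofree_emb f) =
        Idn (Emb C B S) (OMap cofree_emb f)"
      by (simp add: cofree_emb_simps cofree_unit_def Phi_def Emb_simps K_mor_counit_emb_section)
  qed
qed

lemma Emb_forget_cofree_emb: "func_eq (arrow_cat C) (Emb_forget \<circ>\<^sub>F cofree_emb) \<L>"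
  by (auto simp: func_eq_def comp_func_def cofree_emb_simps Emb_forget_simps)

end

section \<open>Equivalence of the three statements\<close>

text \<open>\<open>q\<close> and \<open>R\<close> range over all choices of comma-objects;
  \<open>comma_choice_exists\<close> supplies one from the pullbacks and comma-objects. The induced
  comonad is compared with \<open>L\<close> and \<open>\<Phi>\<close> by equality on the carriers,
  not up to isomorphism.\<close>

theorem theorem10p6:
  fixes C :: "('o, 'm) ordcat" and B :: "('p, 'n) ordcat"
    and S :: "('o, 'm, 'p, 'n) func" and G :: "('p, 'n, 'o, 'm) func"
    and \<eta> :: "'o \<Rightarrow> 'm" and \<epsilon> :: "'p \<Rightarrow> 'n"
    and q R :: "'m \<Rightarrow> 'm"
  assumes C: "ord_category C" and pullbacks: "has_pullbacks C"
    and B: "ord_category B" and commas: "has_comma_objects B"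
    and adjunction: "ord_adjunction C B S G \<eta> \<epsilon>"
    and choice: "comma_choice C S G \<eta> q R"
  shows "(simple_adjunction C B S \<eta> \<epsilon> q R \<longleftrightarrow>
      (\<exists>T \<nu> \<xi>. ord_adjunction (Emb C B S) (arrow_cat C) Emb_forget T \<nu> \<xi> \<and>
         func_eq (arrow_cat C) (Emb_forget \<circ>\<^sub>F T) (L_func C S G \<eta> q R) \<and>
         (\<forall>f\<in>Obj (arrow_cat C). \<xi> f = Phi C \<eta> q R f))) \<and>
    (simple_adjunction C B S \<eta> \<epsilon> q R \<longleftrightarrow>
      (\<exists>\<Sigma>. ord_comonad (arrow_cat C) (L_func C S G \<eta> q R) (Phi C \<eta> q R) \<Sigma> \<and>
         iso_over (Emb C B S) Emb_forget
           (coalgebras (arrow_cat C) (L_func C S G \<eta> q R) (Phi C \<eta> q R) \<Sigma>) coalgebras_forget))"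
proof -
  interpret ord_adjunction C B S G \<eta> \<epsilon> by (rule adjunction)
  interpret comma_factorisation C B S G \<eta> \<epsilon> q R by unfold_locales (rule choice)
  have simple: "simple_comma_factorisation C B S G \<eta> \<epsilon> q R"
    if "simple_adjunction C B S \<eta> \<epsilon> q R"
    using that unfolding simple_iff by unfold_locales blast
  show ?thesis
    using simple_comma_factorisation.Emb_forget_adjunction[OF simple]
      simple_comma_factorisation.Emb_forget_cofree_emb[OF simple]
      simple_comma_factorisation.L_comonad[OF simple]
      simple_comma_factorisation.coalg_forget_iso[OF simple]
      simple_of_comonad simple_of_adjunction
    by blast
qed

end
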